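(* Let $\Gamma = H_3$, $A = A(\Gamma)$ and $W = W(\Gamma)$, and let $w_0$ be the longest element of $W$. Then there are precisely two equivalence classes of proper up-to-center-epimorphisms $A\to W$. These are represented by $\mu'$ and $\nu_3^3$, where $$\mu'(\sigma_1)=s_1w_0,\quad \mu'(\sigma_2)=s_2w_0,\quad \mu'(\sigma_3)=s_3w_0,$$ $$\nu_3^3(\sigma_1)=s_2s_1s_2s_1,\quad \nu_3^3(\sigma_2)=s_2s_1s_2s_1s_3s_2s_1s_2s_1s_3s_2s_1,\quad \nu_3^3(\sigma_3)=s_1s_2s_1s_2.$$
   Context: The Artin group $A=A(H_3)$ is generated by $\sigma_1,\sigma_2,\sigma_3$ subject to $\sigma_1\sigma_2\sigma_1\sigma_2\sigma_1=\sigma_2\sigma_1\sigma_2\sigma_1\sigma_2$, $\sigma_1\sigma_3=\sigma_3\sigma_1$, $\sigma_2\sigma_3\sigma_2=\sigma_3\sigma_2\sigma_3$. The Coxeter group $W=W(H_3)$ is generated by $s_1,s_2,s_3$ subject to $s_1^2=s_2^2=s_3^2=(s_1s_2)^5=(s_1s_3)^2=(s_2s_3)^3=1$. The longest element $w_0$ is the unique element of maximal word length in $W$ with respect to $s_1,s_2,s_3$; it is central in $W$. Let $Z(W)$ denote the center of $W$. A homomorphism $\varphi: A\to W$ is an up-to-center-epimorphism if $W = \mathrm{Im}\,\varphi\cdot Z(W)$; it is proper if moreover it is not an epimorphism (not surjective). Two homomorphisms $\varphi_1,\varphi_2: A\to W$ are equivalent if there is an automorphism $\alpha$ of $W$ such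 that $\varphi_2=\alpha\circ\varphi_1$. *)

theory Defs
  imports "HOL-Algebra.Bij" "HOL-Algebra.Coset"
begin

section \<open>Groups given by generators and relations\<close>

text \<open>A word over the generators \<open>'a\<close> is a list of signed letters: \<open>(a, True)\<close> stands
  for the generator \<open>a\<close> and \<open>(a, False)\<close> for its formal inverse.  A relation
  \<open>u = v\<close> is the pair \<open>(u, v)\<close>, and \<open>same_element R\<close> is the congruence on words
  generated by the relations in \<open>R\<close> and free cancellation.\<close>

type_synonym 'a gword = "('a \<times> bool) list"

definition pos :: "'a list \<Rightarrow> 'a gword" where
  "pos as = map (\<lambda>a. (a, True)) as"

inductive same_element :: "('a gword \<times> 'a gword) set \<Rightarrow> 'a gword \<Rightarrow> 'a gword \<Rightarrow> bool"
  for R where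
  refl: "same_element R u u"
| sym: "same_element R u v \<Longrightarrow> same_element R v u"
| trans: "same_element R u v \<Longrightarrow> same_element R v w \<Longrightarrow> same_element R u w"
| rel: "(u, v) \<in> R \<Longrightarrow> same_element R (x @ u @ y) (x @ v @ y)"
| cancel: "same_element R (x @ [(a, b), (a, \<not> b)] @ y) (x @ y)"

definition word_rel :: "('a gword \<times> 'a gword) set \<Rightarrow> ('a gword \<times> 'a gword) set" where
  "word_rel R = {(u, v). same_element R u v}"

definition presented_group :: "('a gword \<times> 'a gword) set \<Rightarrow> 'a gword set monoid" where
  "presented_group R =
    \<lparr>carrier = UNIV // word_rel R,
     mult = (\<lambda>X Y. \<Union>x\<in>X. \<Union>y\<in>Y. word_rel R `` {x @ y}),
     one = word_rel R `` {[]}\<rparr>"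

definition generator :: "('a gword \<times> 'a gword) set \<Rightarrow> 'a \<Rightarrow> 'a gword set" where
  "generator R a = word_rel R `` {pos [a]}"

lemma equiv_word_rel: "equiv UNIV (word_rel R)"
  by (rule equivI)
    (auto simp: word_rel_def refl_on_def sym_def trans_def
      intro: same_element.refl same_element.sym same_element.trans)

lemma same_element_context:
  "same_element R u v \<Longrightarrow> same_element R (x @ u @ y) (x @ v @ y)"
proof (induction rule: same_element.induct)
  case (rel u v x' y')
  then show ?case
    using same_element.rel[of u v R "x @ x'" "y' @ y"] by simp
next
  case (cancel x' a b y')
  then show ?case
    using same_element.cancel[of R "x @ x'" a b "y' @ y"] by simp
qed (auto intro: same_element.refl same_element.sym same_element.trans)

lemma same_element_append:
  assumes "same_element R u u'" "same_element R v v'"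
  shows "same_element R (u @ v) (u' @ v')"
  using same_element_context[OF assms(1), of "[]" v]
    same_element_context[OF assms(2), of u' "[]"]
  by (auto intro: same_element.trans)

lemma presented_group_mult:
  "word_rel R `` {u} \<otimes>\<^bsub>presented_group R\<^esub> word_rel R `` {v} = word_rel R `` {u @ v}"
proof -
  have "congruent2 (word_rel R) (word_rel R) (\<lambda>x y. word_rel R `` {x @ y})"
    by (intro congruent2I' equiv_class_eq[OF equiv_word_rel])
      (auto simp: word_rel_def intro: same_element_append)
  then show ?thesis
    unfolding presented_group_def
    by (simp add: UN_equiv_class2[OF equiv_word_rel equiv_word_rel])
qed

lemma same_element_inverse:
  "same_element R (rev (map (\<lambda>(a, b). (a, \<not> b)) u) @ u) []"
proof (induction u)
  case Nil
  then show ?case by (simp add: same_element.refl)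
next
  case (Cons l u)
  obtain a b where l: "l = (a, b)" by force
  show ?case
    using same_element.cancel[of R "rev (map (\<lambda>(a, b). (a, \<not> b)) u)" a "\<not> b" u] Cons.IH
    by (auto simp: l intro: same_element.trans)
qed

lemma group_presented_group: "group (presented_group R)"
proof (rule groupI)
  have carr: "\<exists>u. X = word_rel R `` {u}" if "X \<in> carrier (presented_group R)" for X
    using that by (auto simp: presented_group_def quotient_def)
  have in_carr: "word_rel R `` {u} \<in> carrier (presented_group R)" for u
    by (auto simp: presented_group_def quotient_def)
  have one: "\<one>\<^bsub>presented_group R\<^esub> = word_rel R `` {[]}"
    by (simp add: presented_group_def)
  show "\<one>\<^bsub>presented_group R\<^esub> \<in> carrier (presented_group R)"
    by (simp add: one in_carr)
  fix X assume X: "X \<in> carrier (presented_group R)"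
  then obtain u where u: "X = word_rel R `` {u}" using carr by blast
  show "\<one>\<^bsub>presented_group R\<^esub> \<otimes>\<^bsub>presented_group R\<^esub> X = X"
    by (simp add: u one presented_group_mult)
  have "word_rel R `` {rev (map (\<lambda>(a, b). (a, \<not> b)) u)} \<otimes>\<^bsub>presented_group R\<^esub> X
      = \<one>\<^bsub>presented_group R\<^esub>"
    unfolding u one presented_group_mult
    by (rule equiv_class_eq[OF equiv_word_rel]) (simp add: word_rel_def same_element_inverse)
  then show "\<exists>Y\<in>carrier (presented_group R).
      Y \<otimes>\<^bsub>presented_group R\<^esub> X = \<one>\<^bsub>presented_group R\<^esub>"
    using in_carr by blast
  fix Y assume Y: "Y \<in> carrier (presented_group R)"
  then obtain v where v: "Y = word_rel R `` {v}" using carr by blast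
  show "X \<otimes>\<^bsub>presented_group R\<^esub> Y \<in> carrier (presented_group R)"
    by (simp add: u v presented_group_mult in_carr)
  fix Z assume Z: "Z \<in> carrier (presented_group R)"
  then obtain w where w: "Z = word_rel R `` {w}" using carr by blast
  show "X \<otimes>\<^bsub>presented_group R\<^esub> Y \<otimes>\<^bsub>presented_group R\<^esub> Z
      = X \<otimes>\<^bsub>presented_group R\<^esub> (Y \<otimes>\<^bsub>presented_group R\<^esub> Z)"
    by (simp add: u v w presented_group_mult)
qed


section \<open>The Artin group and the Coxeter group of type \<open>H\<^sub>3\<close>\<close>

datatype index = I1 | I2 | I3

definition artin_rels :: "(index gword \<times> index gword) set" where
  "artin_rels =
    {(pos [I1, I2, I1, I2, I1], pos [I2, I1, I2, I1, I2]),
     (pos [I1, I3], pos [I3, I1]),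
     (pos [I2, I3, I2], pos [I3, I2, I3])}"

definition coxeter_rels :: "(index gword \<times> index gword) set" where
  "coxeter_rels =
    {(pos [I1, I1], []), (pos [I2, I2], []), (pos [I3, I3], []),
     (pos (concat (replicate 5 [I1, I2])), []),
     (pos (concat (replicate 2 [I1, I3])), []),
     (pos (concat (replicate 3 [I2, I3])), [])}"

abbreviation A :: "index gword set monoid" where "A \<equiv> presented_group artin_rels"
abbreviation W :: "index gword set monoid" where "W \<equiv> presented_group coxeter_rels"

abbreviation sigma1 ("\<sigma>\<^sub>1") where "\<sigma>\<^sub>1 \<equiv> generator artin_rels I1"
abbreviation sigma2 ("\<sigma>\<^sub>2") where "\<sigma>\<^sub>2 \<equiv> generator artin_rels I2"
abbreviation sigma3 ("\<sigma>\<^sub>3") where "\<sigma>\<^sub>3 \<equiv> generator artin_rels I3"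

abbreviation refl1 ("s\<^sub>1") where "s\<^sub>1 \<equiv> generator coxeter_rels I1"
abbreviation refl2 ("s\<^sub>2") where "s\<^sub>2 \<equiv> generator coxeter_rels I2"
abbreviation refl3 ("s\<^sub>3") where "s\<^sub>3 \<equiv> generator coxeter_rels I3"

definition list_mult :: "('a, 'b) monoid_scheme \<Rightarrow> 'a list \<Rightarrow> 'a" where
  "list_mult G xs = foldr (\<otimes>\<^bsub>G\<^esub>) xs \<one>\<^bsub>G\<^esub>"

text \<open>Inverse letters are not needed in the word length, the \<open>s\<^sub>i\<close> being involutions.\<close>

definition word_length :: "index gword set \<Rightarrow> nat" where
  "word_length x =
    (LEAST n. \<exists>xs. set xs \<subseteq> {s\<^sub>1, s\<^sub>2, s\<^sub>3} \<and> length xs = n \<and> list_mult W xs = x)"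

definition longest_element :: "index gword set" ("w\<^sub>0") where
  "w\<^sub>0 = (THE w. w \<in> carrier W \<and> (\<forall>v\<in>carrier W. word_length v \<le> word_length w))"


section \<open>Up-to-center-epimorphisms\<close>

definition center :: "('a, 'b) monoid_scheme \<Rightarrow> 'a set" where
  "center G = {z \<in> carrier G. \<forall>x\<in>carrier G. z \<otimes>\<^bsub>G\<^esub> x = x \<otimes>\<^bsub>G\<^esub> z}"

definition up_to_center_epi ::
  "('a, 'c) monoid_scheme \<Rightarrow> ('b, 'd) monoid_scheme \<Rightarrow> ('a \<Rightarrow> 'b) set" where
  "up_to_center_epi G H =
    {\<phi> \<in> hom G H. carrier H = (\<phi> ` carrier G) <#>\<^bsub>H\<^esub> center H}"

definition proper_up_to_center_epi ::
  "('a, 'c) monoid_scheme \<Rightarrow> ('b, 'd) monoid_scheme \<Rightarrow> ('a \<Rightarrow> 'b) set" where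
  "proper_up_to_center_epi G H = {\<phi> \<in> up_to_center_epi G H. \<phi> \<notin> epi G H}"

text \<open>Elements of \<^term>\<open>hom G H\<close> are total functions whose values outside
  \<^term>\<open>carrier G\<close> are irrelevant.  Equivalence compares values on the carrier only, so
  that functions representing the same homomorphism are identified (take \<open>\<alpha>\<close> to be the
  identity).\<close>

definition hom_equiv ::
  "('a, 'c) monoid_scheme \<Rightarrow> ('b, 'd) monoid_scheme \<Rightarrow> (('a \<Rightarrow> 'b) \<times> ('a \<Rightarrow> 'b)) set" where
  "hom_equiv G H =
    {(\<phi>\<^sub>1, \<phi>\<^sub>2). \<phi>\<^sub>1 \<in> hom G H \<and> \<phi>\<^sub>2 \<in> hom G H \<and>
      (\<exists>\<alpha>\<in>auto H. \<forall>x\<in>carrier G. \<phi>\<^sub>2 x = \<alpha> (\<phi>\<^sub>1 x))}"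

end

theory Submission
  imports Defs
begin

text \<open>Send \<open>s\<^sub>1, s\<^sub>2, s\<^sub>3\<close> to three involutions of \<open>A\<^sub>5\<close> with sign \<open>-1\<close>; a normal form of length at most
  15 for the elements of \<open>W\<close> shows that this is an isomorphism from \<open>W\<close> onto \<open>A\<^sub>5 \<times> {\<plusminus>1}\<close>.  A
  homomorphism \<open>A \<rightarrow> W\<close> is then a solution \<open>(x, y, z)\<close> of the Artin relations in \<open>A\<^sub>5\<close> together with
  one sign, as the \<open>\<sigma>\<^sub>i\<close> are conjugate.  Up to conjugation in the symmetric group \<open>S\<^sub>5\<close>, which acts on
  \<open>W\<close> by automorphisms, the only solutions with \<open>x, y, z\<close> not all equal are the images of the \<open>s\<^sub>i\<close>
  and those of the \<open>\<nu>(\<sigma>\<^sub>i)\<close>.  Both generate \<open>A\<^sub>5\<close>.  The homomorphism is proper exactly when the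
  sign is \<open>+1\<close>: for the sign \<open>-1\<close> the image contains \<open>w\<^sub>0\<close>, since \<open>xyz\<close> has order 5 in \<open>A\<^sub>5\<close>.\<close>

section \<open>A rewriting system for \<open>W\<close>\<close>

definition word_equal :: "index list \<Rightarrow> index list \<Rightarrow> bool" (infix "\<doteq>" 50) where
  "u \<doteq> v \<longleftrightarrow> same_element coxeter_rels (pos u) (pos v)"

lemma pos_append: "pos (u @ v) = pos u @ pos v"
  by (simp add: pos_def)

lemma word_equal_refl: "u \<doteq> u"
  by (simp add: word_equal_def same_element.refl)

lemma word_equal_sym: "u \<doteq> v \<Longrightarrow> v \<doteq> u"
  by (simp add: word_equal_def same_element.sym)

lemma word_equal_trans [trans]: "u \<doteq> v \<Longrightarrow> v \<doteq> w \<Longrightarrow> u \<doteq> w"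
  unfolding word_equal_def by (rule same_element.trans)

lemma word_equal_append: "u \<doteq> u' \<Longrightarrow> v \<doteq> v' \<Longrightarrow> u @ v \<doteq> u' @ v'"
  by (simp add: word_equal_def pos_append same_element_append)

lemma word_equal_Cons: "u \<doteq> v \<Longrightarrow> i # u \<doteq> i # v"
  using word_equal_append[OF word_equal_refl, of u v "[i]"] by simp

fun strip_prefix :: "'a list \<Rightarrow> 'a list \<Rightarrow> 'a list option" where
  "strip_prefix [] w = Some w"
| "strip_prefix (x # l) [] = None"
| "strip_prefix (x # l) (y # w) = (if x = y then strip_prefix l w else None)"

lemma strip_prefixD: "strip_prefix l w = Some v \<Longrightarrow> w = l @ v"
  by (induction l w rule: strip_prefix.induct) (auto split: if_splits)

type_synonym rules = "(index list \<times> index list) list"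

primrec rewrite_head :: "rules \<Rightarrow> index list \<Rightarrow> index list option" where
  "rewrite_head [] w = None"
| "rewrite_head (r # rs) w =
    (case strip_prefix (fst r) w of Some v \<Rightarrow> Some (snd r @ v) | None \<Rightarrow> rewrite_head rs w)"

primrec rewrite_step :: "rules \<Rightarrow> index list \<Rightarrow> index list option" where
  "rewrite_step rs [] = None"
| "rewrite_step rs (i # w) =
    (case rewrite_head rs (i # w) of Some v \<Rightarrow> Some v
     | None \<Rightarrow> map_option ((#) i) (rewrite_step rs w))"

text \<open>The fuel makes the recursion primitive, so that no termination proof for a rule set is
  required. Soundness holds for every amount of fuel, and each later computation checks that the
  chosen amount is enough.\<close>

primrec rewrite :: "nat \<Rightarrow> rules \<Rightarrow> index list \<Rightarrow> index list" where
  "rewrite 0 rs w = w"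
| "rewrite (Suc n) rs w = (case rewrite_step rs w of Some v \<Rightarrow> rewrite n rs v | None \<Rightarrow> w)"

text \<open>The length condition ensures that rewriting never lengthens a word; this is what later
  makes normal words shortest words.\<close>

definition sound :: "rules \<Rightarrow> bool" where
  "sound rs \<longleftrightarrow> (\<forall>(l, r)\<in>set rs. l \<doteq> r \<and> length r \<le> length l)"

lemma rewrite_head_sound:
  "sound rs \<Longrightarrow> rewrite_head rs w = Some v \<Longrightarrow> w \<doteq> v \<and> length v \<le> length w"
proof (induction rs)
  case (Cons r rs)
  show ?case
  proof (cases "strip_prefix (fst r) w")
    case None
    then show ?thesis using Cons by (simp add: sound_def)
  next
    case (Some v')
    from Cons.prems(1) have "fst r \<doteq> snd r" "length (snd r) \<le> length (fst r)"
      by (auto simp: sound_def)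
    with strip_prefixD[OF Some] Cons.prems(2) Some show ?thesis
      by (auto intro: word_equal_append word_equal_refl)
  qed
qed simp

lemma rewrite_step_sound:
  "sound rs \<Longrightarrow> rewrite_step rs w = Some v \<Longrightarrow> w \<doteq> v \<and> length v \<le> length w"
proof (induction w arbitrary: v)
  case (Cons i w)
  then show ?case
    using rewrite_head_sound[OF Cons.prems(1), of "i # w"]
    by (auto simp del: rewrite_head.simps split: option.splits intro: word_equal_Cons)
qed simp

lemma rewrite_sound: "sound rs \<Longrightarrow> w \<doteq> rewrite n rs w \<and> length (rewrite n rs w) \<le> length w"
proof (induction n arbitrary: w)
  case (Suc n)
  show ?case
  proof (cases "rewrite_step rs w")
    case (Some v)
    with rewrite_step_sound[OF Suc.prems Some] Suc.IH[OF Suc.prems, of v] show ?thesis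
      by (auto intro: word_equal_trans)
  qed (simp add: word_equal_refl)
qed (simp add: word_equal_refl)

text \<open>Derives a new rule by rewriting one word \<open>w\<close> in two ways, as in the
  resolution of a critical pair.\<close>

lemma joinable:
  assumes "sound rs" "sound rs'" "rewrite n rs w = u" "rewrite n rs' w = v"
  shows "u \<doteq> v"
  using assms rewrite_sound word_equal_sym word_equal_trans by metis

lemma coxeter_relation:
  "sound [([I1, I1], [])]" "sound [([I2, I2], [])]" "sound [([I3, I3], [])]"
  "sound [([I1, I2, I1, I2, I1, I2, I1, I2, I1, I2], [])]"
  "sound [([I1, I3, I1, I3], [])]"
  "sound [([I2, I3, I2, I3, I2, I3], [])]"
  using same_element.rel[of _ _ coxeter_rels "[]" "[]"]
  by (auto simp: sound_def word_equal_def coxeter_rels_def numeral_eq_Suc pos_def)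

lemma sound_Cons: "sound (r # rs) \<longleftrightarrow> fst r \<doteq> snd r \<and> length (snd r) \<le> length (fst r) \<and> sound rs"
  by (auto simp: sound_def)

abbreviation involution_rules :: rules where
  "involution_rules \<equiv> [([I1, I1], []), ([I2, I2], []), ([I3, I3], [])]"

lemma sound_involutions: "sound involution_rules"
  using coxeter_relation(1-3) by (simp add: sound_Cons)

definition coxeter_rules :: rules where
  "coxeter_rules = involution_rules @
    [([I3, I1], [I1, I3]),
     ([I3, I2, I3], [I2, I3, I2]),
     ([I2, I1, I2, I1, I2], [I1, I2, I1, I2, I1]),
     ([I3, I2, I1, I3], [I2, I3, I2, I1]),
     ([I3, I2, I1, I2, I3, I2], [I2, I3, I2, I1, I2, I3]),
     ([I3, I2, I1, I2, I1, I3, I2, I1, I2, I1], [I2, I3, I2, I1, I2, I1, I3, I2, I1, I2])]"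

text \<open>The last three rules come from the Knuth-Bendix completion of the braid relations for the
  length-lexicographic order.\<close>

lemma sound_coxeter_rules: "sound coxeter_rules"
proof -
  \<comment> \<open>In the first three cases \<open>w\<close> is one side of a braid relation
    followed by a Coxeter relator. Deleting the relator leaves that side; cancelling squares leaves
    the other one.\<close>
  have 1: "[I3, I1] \<doteq> [I1, I3]"
    by (rule joinable[where w = "[I3, I1, I1, I3, I1, I3]" and n = 2,
          OF coxeter_relation(5) sound_involutions]) code_simp+
  have 2: "[I3, I2, I3] \<doteq> [I2, I3, I2]"
    by (rule joinable[where w = "[I2, I3, I2, I2, I3, I2, I3, I2, I3]" and n = 3,
          OF sound_involutions coxeter_relation(6)]) code_simp+
  have 3: "[I2, I1, I2, I1, I2] \<doteq> [I1, I2, I1, I2, I1]"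
    by (rule joinable[where n = 5 and
            w = "[I1, I2, I1, I2, I1, I1, I2, I1, I2, I1, I2, I1, I2, I1, I2]",
          OF sound_involutions coxeter_relation(4)]) code_simp+
  have s1: "sound [([I3, I1], [I1, I3])]" and s2: "sound [([I3, I2, I3], [I2, I3, I2])]"
    and s3: "sound [([I2, I1, I2, I1, I2], [I1, I2, I1, I2, I1])]"
    using 1 2 3 by (auto simp: sound_def)
  \<comment> \<open>From here on \<open>w\<close> is the overlap, in a single letter, of the
    left-hand sides of two rules already obtained.\<close>
  have 4: "[I3, I2, I1, I3] \<doteq> [I2, I3, I2, I1]"
    by (rule joinable[where w = "[I3, I2, I3, I1]" and n = 1, OF s1 s2]) code_simp+
  then have s4: "sound [([I3, I2, I1, I3], [I2, I3, I2, I1])]"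
    by (auto simp: sound_def)
  have 5: "[I3, I2, I1, I2, I3, I2] \<doteq> [I2, I3, I2, I1, I2, I3]"
    by (rule joinable[where w = "[I3, I2, I1, I3, I2, I3]" and n = 1, OF s2 s4]) code_simp+
  with 1 have s5: "sound [([I3, I1], [I1, I3]), ([I3, I2, I1, I2, I3, I2], [I2, I3, I2, I1, I2, I3])]"
    by (auto simp: sound_def)
  have s3': "sound [([I3, I1], [I1, I3]), ([I2, I1, I2, I1, I2], [I1, I2, I1, I2, I1])]"
    using 1 3 by (auto simp: sound_def)
  have 6: "[I3, I2, I1, I2, I1, I3, I2, I1, I2, I1] \<doteq> [I2, I3, I2, I1, I2, I1, I3, I2, I1, I2]"
    by (rule joinable[where w = "[I3, I2, I1, I2, I3, I2, I1, I2, I1, I2]" and n = 2,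
          OF s3' s5]) code_simp+
  show ?thesis
    using sound_involutions 1 2 3 4 5 6 by (simp add: coxeter_rules_def sound_Cons)
qed


text \<open>The words irreducible for \<open>coxeter_rules\<close>: a reduced word of the dihedral parabolic
  \<open>\<langle>s\<^sub>1, s\<^sub>2\<rangle>\<close> followed by a minimal coset representative.\<close>

definition dihedral_words :: "index list list" where
  "dihedral_words =
    [[], [I1], [I2], [I1, I2], [I2, I1], [I1, I2, I1], [I2, I1, I2], [I1, I2, I1, I2],
     [I2, I1, I2, I1], [I1, I2, I1, I2, I1]]"

definition coset_words :: "index list list" where
  "coset_words =
    [[], [I3], [I3, I2], [I3, I2, I1], [I3, I2, I1, I2], [I3, I2, I1, I2, I1],
     [I3, I2, I1, I2, I3], [I3, I2, I1, I2, I1, I3], [I3, I2, I1, I2, I1, I3, I2],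
     [I3, I2, I1, I2, I1, I3, I2, I1], [I3, I2, I1, I2, I1, I3, I2, I1, I2],
     [I3, I2, I1, I2, I1, I3, I2, I1, I2, I3]]"

definition normal_words :: "index list list" where
  "normal_words = concat (map (\<lambda>d. map (\<lambda>u. u @ d) dihedral_words) coset_words)"

lemma normal_words_iff:
  "w \<in> set normal_words \<longleftrightarrow> (\<exists>d\<in>set coset_words. \<exists>u\<in>set dihedral_words. w = u @ d)"
  by (auto simp: normal_words_def)

text \<open>A dihedral word contains no \<open>I3\<close> and a nonempty coset word begins with
  \<open>I3\<close>, so cutting at the first \<open>I3\<close> recovers the two factors. Membership
  is thus tested in lists of 10 and 12 words instead of one list of 120.\<close>

lemma coset_decomposition:
  "\<forall>w\<in>set normal_words. \<forall>i\<in>set [I1, I2, I3].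
    let v = rewrite 11 coxeter_rules (i # w) in
    takeWhile (\<lambda>i. i \<noteq> I3) v \<in> set dihedral_words \<and>
    dropWhile (\<lambda>i. i \<noteq> I3) v \<in> set coset_words"
  by code_simp

lemma normal_words_closed:
  "\<forall>w\<in>set normal_words. \<forall>i\<in>set [I1, I2, I3].
    rewrite 11 coxeter_rules (i # w) \<in> set normal_words"
  using coset_decomposition unfolding normal_words_iff Let_def
  by (metis takeWhile_dropWhile_id)

section \<open>Reduction of arbitrary words to normal words\<close>

lemma set_indices: "set [I1, I2, I3] = UNIV"
  using index.exhaust by auto

text \<open>Induction on the word: a letter put in front of a normal word is rewritten to a normal
  word again. The length bound is kept for the computation of \<open>word_length\<close>.\<close>

lemma normal_form: "\<exists>w\<in>set normal_words. u \<doteq> w \<and> length w \<le> length u"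
proof (induction u)
  case Nil
  have "[] \<in> set normal_words" by code_simp
  then show ?case using word_equal_refl by auto
next
  case (Cons i u)
  then obtain w where w: "w \<in> set normal_words" "u \<doteq> w" "length w \<le> length u" by blast
  let ?v = "rewrite 11 coxeter_rules (i # w)"
  have "i # w \<doteq> ?v" "length ?v \<le> length (i # w)"
    using rewrite_sound[OF sound_coxeter_rules, of "i # w" 11] by blast+
  then have "i # u \<doteq> ?v" "length ?v \<le> length (i # u)"
    using word_equal_trans[OF word_equal_Cons[OF w(2)]] w(3) by auto
  moreover have "?v \<in> set normal_words"
    using normal_words_closed w(1) set_indices by blast
  ultimately show ?case by blast
qed

text \<open>Generators are involutions: the word consisting of the inverse letter followed by the
  generator twice reduces both to the inverse letter and to the generator.\<close>

lemma unsigned_word: "same_element coxeter_rels u (pos (map fst u))"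
proof (induction u)
  case Nil
  then show ?case by (simp add: pos_def same_element.refl)
next
  case (Cons l u)
  obtain i b where l: "l = (i, b)" by force
  have "([(i, True), (i, True)], []) \<in> coxeter_rels"
    by (cases i) (simp_all add: coxeter_rels_def pos_def)
  then have "same_element coxeter_rels ([(i, False)] @ [(i, True), (i, True)] @ []) [(i, False)]"
    using same_element.rel[of "[(i, True), (i, True)]" "[]" coxeter_rels "[(i, False)]" "[]"]
    by simp
  moreover have "same_element coxeter_rels ([(i, False)] @ [(i, True), (i, True)] @ []) [(i, True)]"
    using same_element.cancel[of coxeter_rels "[]" i False "[(i, True)]"] by simp
  ultimately have "same_element coxeter_rels [l] [(i, True)]"
    unfolding l by (cases b) (auto intro: same_element.refl same_element.sym same_element.trans)
  from same_element_append[OF this Cons.IH] show ?case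
    by (simp add: l pos_def)
qed


section \<open>The model of \<open>W\<close>\<close>

text \<open>\<open>W\<close> is realised as \<open>A\<^sub>5 \<times> {\<plusminus>1}\<close>, with \<open>True\<close> for the sign \<open>-1\<close>.  Permutations are stored
  as tables of values; arbitrary self-maps of the five points are allowed as tables.\<close>

datatype point = P0 | P1 | P2 | P3 | P4

datatype perm = Perm point point point point point

fun app :: "perm \<Rightarrow> point \<Rightarrow> point" where
  "app (Perm a b c d e) P0 = a"
| "app (Perm a b c d e) P1 = b"
| "app (Perm a b c d e) P2 = c"
| "app (Perm a b c d e) P3 = d"
| "app (Perm a b c d e) P4 = e"

fun perm_comp :: "perm \<Rightarrow> perm \<Rightarrow> perm" (infixl "\<cdot>" 70) where
  "p \<cdot> Perm a b c d e = Perm (app p a) (app p b) (app p c) (app p d) (app p e)"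

definition ide :: perm where
  "ide = Perm P0 P1 P2 P3 P4"

text \<open>\<open>P4\<close> is returned without a test, so \<open>perm_inverse\<close> yields an
  inverse only for bijective tables; \<open>normalizing\<close> demands this explicitly.\<close>

definition preimage :: "perm \<Rightarrow> point \<Rightarrow> point" where
  "preimage p x = (if app p P0 = x then P0 else if app p P1 = x then P1
    else if app p P2 = x then P2 else if app p P3 = x then P3 else P4)"

definition perm_inverse :: "perm \<Rightarrow> perm" where
  "perm_inverse p = Perm (preimage p P0) (preimage p P1) (preimage p P2) (preimage p P3) (preimage p P4)"

lemma app_comp: "app (p \<cdot> q) x = app p (app q x)"
  by (cases q; cases x) simp_all

lemma comp_assoc: "p \<cdot> q \<cdot> r = p \<cdot> (q \<cdot> r)"
  by (cases r) (simp add: app_comp)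

lemma ide_comp [simp]: "ide \<cdot> p = p"
proof -
  have "app ide x = x" for x by (cases x) (simp_all add: ide_def)
  then show ?thesis by (cases p) simp
qed

lemma comp_ide [simp]: "p \<cdot> ide = p"
  by (cases p) (simp add: ide_def)

type_synonym elt = "perm \<times> bool"

fun mul :: "elt \<Rightarrow> elt \<Rightarrow> elt" (infixl "\<odot>" 70) where
  "(p, b) \<odot> (q, c) = (p \<cdot> q, b \<noteq> c)"

definition unit_elt :: elt where
  "unit_elt = (ide, False)"

lemma mul_assoc: "x \<odot> y \<odot> z = x \<odot> (y \<odot> z)"
  by (cases x; cases y; cases z) (auto simp: comp_assoc)

lemma unit_elt_mul [simp]: "unit_elt \<odot> x = x"
  by (cases x) (simp add: unit_elt_def)

lemma mul_unit_elt [simp]: "x \<odot> unit_elt = x"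
  by (cases x) (simp add: unit_elt_def)

lemma fst_mul [simp]: "fst (x \<odot> y) = fst x \<cdot> fst y"
  by (cases x; cases y) simp

lemma snd_mul [simp]: "snd (x \<odot> y) = (snd x \<noteq> snd y)"
  by (cases x; cases y) simp

definition product :: "elt list \<Rightarrow> elt" where
  "product xs = foldr (\<odot>) xs unit_elt"

lemma product_simps [simp]: "product [] = unit_elt" "product (x # xs) = x \<odot> product xs"
  by (simp_all add: product_def)

lemma product_append: "product (xs @ ys) = product xs \<odot> product ys"
  by (induction xs) (simp_all add: mul_assoc)

text \<open>Three double transpositions: the product of the first two has order 5, of the first and
  third order 2, of the last two order 3. Geometrically a reflection is minus a half-turn of the
  icosahedron.\<close>

fun gen_perm :: "index \<Rightarrow> perm" where
  "gen_perm I1 = Perm P0 P2 P1 P4 P3"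
| "gen_perm I2 = Perm P1 P0 P3 P2 P4"
| "gen_perm I3 = Perm P0 P4 P3 P2 P1"

section \<open>Evaluation of words in the model\<close>

definition eval_word :: "index list \<Rightarrow> elt" where
  "eval_word w = product (map (\<lambda>i. (gen_perm i, True)) w)"

lemma eval_word_append: "eval_word (u @ v) = eval_word u \<odot> eval_word v"
  by (simp add: eval_word_def product_append)

text \<open>The permutations satisfy the Coxeter relations, and all relators have even length, so
  the signs cancel too. Reading an inverse letter as the generator is harmless because each
  generator evaluates to an involution.\<close>

lemma eval_word_same_element:
  "same_element coxeter_rels u v \<Longrightarrow> eval_word (map fst u) = eval_word (map fst v)"
proof (induction rule: same_element.induct)
  case (rel u v x y)
  then have "eval_word (map fst u) = eval_word (map fst v)"
    by (auto simp: coxeter_rels_def pos_def numeral_eq_Suc eval_word_def unit_elt_def ide_def)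
  then show ?case by (simp add: eval_word_append)
next
  case (cancel x a b y)
  have "eval_word [a, a] = unit_elt"
    by (cases a) (simp_all add: eval_word_def unit_elt_def ide_def)
  then show ?case
    using eval_word_append[of "[a, a]" "map fst y"] by (simp add: eval_word_append)
qed auto

text \<open>An explicit list keeps quantifiers over \<open>A_5\<close> executable. Closure under
  composition is obtained later from the group \<open>W\<close>.\<close>

definition alternating :: "perm list" where
  "alternating =
  [Perm P0 P1 P2 P3 P4, Perm P0 P1 P3 P4 P2, Perm P0 P1 P4 P2 P3,
   Perm P0 P2 P1 P4 P3, Perm P0 P2 P3 P1 P4, Perm P0 P2 P4 P3 P1,
   Perm P0 P3 P1 P2 P4, Perm P0 P3 P2 P4 P1, Perm P0 P3 P4 P1 P2,
   Perm P0 P4 P1 P3 P2, Perm P0 P4 P2 P1 P3, Perm P0 P4 P3 P2 P1,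
   Perm P1 P0 P2 P4 P3, Perm P1 P0 P3 P2 P4, Perm P1 P0 P4 P3 P2,
   Perm P1 P2 P0 P3 P4, Perm P1 P2 P3 P4 P0, Perm P1 P2 P4 P0 P3,
   Perm P1 P3 P0 P4 P2, Perm P1 P3 P2 P0 P4, Perm P1 P3 P4 P2 P0,
   Perm P1 P4 P0 P2 P3, Perm P1 P4 P2 P3 P0, Perm P1 P4 P3 P0 P2,
   Perm P2 P0 P1 P3 P4, Perm P2 P0 P3 P4 P1, Perm P2 P0 P4 P1 P3,
   Perm P2 P1 P0 P4 P3, Perm P2 P1 P3 P0 P4, Perm P2 P1 P4 P3 P0,
   Perm P2 P3 P0 P1 P4, Perm P2 P3 P1 P4 P0, Perm P2 P3 P4 P0 P1,
   Perm P2 P4 P0 P3 P1, Perm P2 P4 P1 P0 P3, Perm P2 P4 P3 P1 P0,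
   Perm P3 P0 P1 P4 P2, Perm P3 P0 P2 P1 P4, Perm P3 P0 P4 P2 P1,
   Perm P3 P1 P0 P2 P4, Perm P3 P1 P2 P4 P0, Perm P3 P1 P4 P0 P2,
   Perm P3 P2 P0 P4 P1, Perm P3 P2 P1 P0 P4, Perm P3 P2 P4 P1 P0,
   Perm P3 P4 P0 P1 P2, Perm P3 P4 P1 P2 P0, Perm P3 P4 P2 P0 P1,
   Perm P4 P0 P1 P2 P3, Perm P4 P0 P2 P3 P1, Perm P4 P0 P3 P1 P2,
   Perm P4 P1 P0 P3 P2, Perm P4 P1 P2 P0 P3, Perm P4 P1 P3 P2 P0,
   Perm P4 P2 P0 P1 P3, Perm P4 P2 P1 P3 P0, Perm P4 P2 P3 P0 P1,
   Perm P4 P3 P0 P2 P1, Perm P4 P3 P1 P0 P2, Perm P4 P3 P2 P1 P0]"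

definition elements :: "elt list" where
  "elements = map eval_word normal_words"

lemma elements_distinct: "distinct elements"
  by code_simp

text \<open>By counting: the 120 distinct values of normal words lie in a set of 60 times 2
  elements, hence exhaust it.\<close>

lemma elements_alternating: "set elements = set alternating \<times> UNIV"
proof (rule card_subset_eq)
  have "\<forall>x\<in>set elements. fst x \<in> set alternating"
    by code_simp
  then show "set elements \<subseteq> set alternating \<times> UNIV"
    by (auto simp: mem_Times_iff)
  have "distinct alternating" "length alternating = 60" "length elements = 120"
    by code_simp+
  then show "card (set elements) = card (set alternating \<times> (UNIV :: bool set))"
    using elements_distinct by (simp add: distinct_card card_cartesian_product)
qed simp


section \<open>Homomorphisms from a presented group\<close>

definition word_value :: "('b, 'c) monoid_scheme \<Rightarrow> ('a \<Rightarrow> 'b) \<Rightarrow> 'a gword \<Rightarrow> 'b" where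
  "word_value G f w = foldr (\<lambda>(a, b) x. (if b then f a else inv\<^bsub>G\<^esub> f a) \<otimes>\<^bsub>G\<^esub> x) w \<one>\<^bsub>G\<^esub>"

abbreviation word_class :: "('a gword \<times> 'a gword) set \<Rightarrow> 'a gword \<Rightarrow> 'a gword set" where
  "word_class R u \<equiv> word_rel R `` {u}"

lemma word_class_eq_iff: "word_class R u = word_class R v \<longleftrightarrow> same_element R u v"
  by (subst eq_equiv_class_iff[OF equiv_word_rel]) (simp_all add: word_rel_def)

lemma word_class_carrier [simp]: "word_class R u \<in> carrier (presented_group R)"
  by (auto simp: presented_group_def quotient_def)

lemma carrier_presented_groupE:
  assumes "X \<in> carrier (presented_group R)"
  obtains u where "X = word_class R u"
  using assms by (auto simp: presented_group_def quotient_def)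

lemma one_presented_group: "\<one>\<^bsub>presented_group R\<^esub> = word_class R []"
  by (simp add: presented_group_def)

lemma generator_carrier [simp]: "generator R a \<in> carrier (presented_group R)"
  by (simp add: generator_def)

lemma inv_generator: "inv\<^bsub>presented_group R\<^esub> generator R a = word_class R [(a, False)]"
proof (rule group.inv_equality[OF group_presented_group])
  show "word_class R [(a, False)] \<otimes>\<^bsub>presented_group R\<^esub> generator R a = \<one>\<^bsub>presented_group R\<^esub>"
    using same_element.cancel[of R "[]" a False "[]"]
    by (simp add: generator_def presented_group_mult one_presented_group word_class_eq_iff pos_def)
qed simp_all

context group
begin

lemma word_value_closed: "(\<And>a. f a \<in> carrier G) \<Longrightarrow> word_value G f u \<in> carrier G"
  by (induction u) (auto simp: word_value_def)

lemma word_value_append: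
  assumes "\<And>a. f a \<in> carrier G"
  shows "word_value G f (u @ v) = word_value G f u \<otimes> word_value G f v"
proof (induction u)
  case Nil
  then show ?case using word_value_closed[of f, OF assms] by (simp add: word_value_def)
next
  case (Cons l u)
  then show ?case
    using word_value_closed[of f u, OF assms] word_value_closed[of f v, OF assms] assms
    by (auto simp: word_value_def m_assoc split: prod.splits)
qed

lemma word_value_pos:
  "word_value G f (pos as) = list_mult G (map f as)"
  by (induction as) (auto simp: word_value_def list_mult_def pos_def)

lemma word_value_subgroup:
  "subgroup K G \<Longrightarrow> (\<And>a. f a \<in> K) \<Longrightarrow> word_value G f u \<in> K"
  by (induction u)
    (auto simp: word_value_def subgroup.one_closed subgroup.m_closed subgroup.m_inv_closed)

lemma word_value_same_element:
  assumes "\<And>a. f a \<in> carrier G"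
    and "\<And>u v. (u, v) \<in> R \<Longrightarrow> word_value G f u = word_value G f v"
  shows "same_element R u v \<Longrightarrow> word_value G f u = word_value G f v"
proof (induction rule: same_element.induct)
  case (rel u v x y)
  then show ?case by (simp add: word_value_append[of f, OF assms(1)] assms(2))
next
  case (cancel x a b y)
  have "word_value G f [(a, b), (a, \<not> b)] = \<one>"
    using assms(1)[of a] by (cases b) (simp_all add: word_value_def)
  then have "word_value G f ([(a, b), (a, \<not> b)] @ y) = word_value G f y"
    using word_value_closed[of f, OF assms(1)] by (simp only: word_value_append[of f, OF assms(1)]) simp
  then show ?case by (simp only: word_value_append[of f, OF assms(1)])
qed auto

text \<open>The existence half of the universal property. A class is sent to the value of a chosen
  word in it, and \<open>word_value_same_element\<close> makes the choice immaterial.\<close>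

lemma presented_group_lift:
  assumes "\<And>a. f a \<in> carrier G"
    and "\<And>u v. (u, v) \<in> R \<Longrightarrow> word_value G f u = word_value G f v"
  obtains \<phi> where "\<phi> \<in> hom (presented_group R) G" "\<And>a. \<phi> (generator R a) = f a"
proof
  define \<phi> where "\<phi> X = word_value G f (SOME u. u \<in> X)" for X
  have \<phi>: "\<phi> (word_class R u) = word_value G f u" for u
  proof -
    have "u \<in> word_class R u"
      by (simp add: word_rel_def same_element.refl)
    then have "(SOME v. v \<in> word_class R u) \<in> word_class R u"
      by (rule someI)
    then have "same_element R u (SOME v. v \<in> word_class R u)"
      by (simp add: word_rel_def)
    from word_value_same_element[OF assms this] show ?thesis
      by (simp add: \<phi>_def)
  qed
  show "\<phi> \<in> hom (presented_group R) G"
  proof (rule homI)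
    fix X assume "X \<in> carrier (presented_group R)"
    then obtain u where u: "X = word_class R u" by (rule carrier_presented_groupE)
    then show "\<phi> X \<in> carrier G"
      using word_value_closed[of f, OF assms(1)] \<phi> by simp
    fix Y assume "Y \<in> carrier (presented_group R)"
    then obtain v where v: "Y = word_class R v" by (rule carrier_presented_groupE)
    show "\<phi> (X \<otimes>\<^bsub>presented_group R\<^esub> Y) = \<phi> X \<otimes> \<phi> Y"
      by (simp add: u v presented_group_mult \<phi> word_value_append[of f, OF assms(1)])
  qed
  show "\<phi> (generator R a) = f a" for a
    using assms(1) by (simp add: generator_def \<phi> word_value_def pos_def)
qed

lemma hom_word_value:
  assumes "\<phi> \<in> hom (presented_group R) G"
  shows "\<phi> (word_class R u) = word_value G (\<lambda>a. \<phi> (generator R a)) u"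
proof -
  interpret group_hom "presented_group R" G \<phi>
    using assms by (simp add: group_hom_def group_hom_axioms_def group_presented_group is_group)
  show ?thesis
  proof (induction u)
    case Nil
    then show ?case using hom_one by (simp add: word_value_def one_presented_group)
  next
    case (Cons l u)
    obtain a b where l: "l = (a, b)" by force
    have "word_class R (l # u) = word_class R [l] \<otimes>\<^bsub>presented_group R\<^esub> word_class R u"
      by (simp add: presented_group_mult)
    moreover have "\<phi> (word_class R [l])
        = (if b then \<phi> (generator R a) else inv \<phi> (generator R a))"
    proof (cases b)
      case True
      then show ?thesis by (simp add: l generator_def pos_def)
    next
      case False
      then show ?thesis
        using hom_inv[OF generator_carrier, of a] by (simp add: l inv_generator)
    qed
    ultimately have "\<phi> (word_class R (l # u))
        = (if b then \<phi> (generator R a) else inv \<phi> (generator R a)) \<otimes> \<phi> (word_class R u)"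
      using hom_mult[OF word_class_carrier word_class_carrier] by simp
    then show ?case
      using Cons by (simp add: word_value_def l)
  qed
qed

lemma hom_presented_group_eqI:
  assumes "\<phi> \<in> hom (presented_group R) G" "\<psi> \<in> hom (presented_group R) G"
    and "\<And>a. \<phi> (generator R a) = \<psi> (generator R a)" "X \<in> carrier (presented_group R)"
  shows "\<phi> X = \<psi> X"
  using assms(3,4)
  by (auto elim!: carrier_presented_groupE simp: hom_word_value[OF assms(1)] hom_word_value[OF assms(2)])

end


section \<open>Coordinates on \<open>W\<close>\<close>

interpretation W: group W
  by (rule group_presented_group)

definition coord :: "index gword set \<Rightarrow> elt" where
  "coord X = eval_word (map fst (SOME u. u \<in> X))"

lemma map_fst_pos [simp]: "map fst (pos u) = u"
  by (induction u) (simp_all add: pos_def)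

lemma coord_word_class: "coord (word_class coxeter_rels u) = eval_word (map fst u)"
proof -
  have "u \<in> word_class coxeter_rels u"
    by (simp add: word_rel_def same_element.refl)
  then have "(SOME v. v \<in> word_class coxeter_rels u) \<in> word_class coxeter_rels u"
    by (rule someI)
  then have "same_element coxeter_rels u (SOME v. v \<in> word_class coxeter_rels u)"
    by (simp add: word_rel_def)
  from eval_word_same_element[OF this] show ?thesis
    by (simp add: coord_def)
qed

lemma carrier_W_normal:
  assumes "X \<in> carrier W"
  obtains w where "w \<in> set normal_words" "X = word_class coxeter_rels (pos w)"
proof -
  obtain u where u: "X = word_class coxeter_rels u"
    using assms by (rule carrier_presented_groupE)
  obtain w where w: "w \<in> set normal_words" "map fst u \<doteq> w"
    using normal_form by blast
  have "same_element coxeter_rels u (pos w)"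
    using unsigned_word w(2) unfolding word_equal_def by (rule same_element.trans)
  then have "X = word_class coxeter_rels (pos w)"
    by (simp add: u word_class_eq_iff)
  with w(1) show ?thesis by (rule that)
qed

lemma eval_word_inj: "inj_on eval_word (set normal_words)"
  using elements_distinct by (simp add: elements_def distinct_map)

text \<open>Each element is the class of a normal word, and different normal words evaluate
  differently. Equations in \<open>W\<close> thereby become computations in the model.\<close>

lemma coord_inj: "X \<in> carrier W \<Longrightarrow> Y \<in> carrier W \<Longrightarrow> coord X = coord Y \<Longrightarrow> X = Y"
  by (elim carrier_W_normal) (auto simp: coord_word_class dest: inj_onD[OF eval_word_inj])

lemma coord_image: "coord ` carrier W = set alternating \<times> UNIV"
proof -
  have "coord ` carrier W = eval_word ` set normal_words"
  proof
    show "coord ` carrier W \<subseteq> eval_word ` set normal_words"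
      by (auto elim!: carrier_W_normal simp: coord_word_class)
    show "eval_word ` set normal_words \<subseteq> coord ` carrier W"
    proof
      fix x assume "x \<in> eval_word ` set normal_words"
      then obtain w where "x = coord (word_class coxeter_rels (pos w))"
        by (auto simp: coord_word_class)
      then show "x \<in> coord ` carrier W"
        by (metis imageI word_class_carrier)
    qed
  qed
  then show ?thesis
    using elements_alternating by (simp add: elements_def)
qed

lemma coord_surj:
  assumes "p \<in> set alternating"
  obtains X where "X \<in> carrier W" "coord X = (p, b)"
  using assms coord_image by (metis (no_types, lifting) SigmaI UNIV_I imageE)

lemma coord_alternating: "X \<in> carrier W \<Longrightarrow> fst (coord X) \<in> set alternating"
  using coord_image by (metis imageI mem_Times_iff)

lemma coord_mult:
  assumes "X \<in> carrier W" "Y \<in> carrier W"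
  shows "coord (X \<otimes>\<^bsub>W\<^esub> Y) = coord X \<odot> coord Y"
  using assms
  by (auto elim!: carrier_presented_groupE
    simp: presented_group_mult coord_word_class eval_word_append)

lemma coord_one: "coord \<one>\<^bsub>W\<^esub> = unit_elt"
  by (simp add: one_presented_group coord_word_class eval_word_def)

lemma coord_generator: "coord (generator coxeter_rels i) = (gen_perm i, True)"
  by (simp add: generator_def coord_word_class eval_word_def unit_elt_def)

lemma list_mult_closed: "set xs \<subseteq> carrier W \<Longrightarrow> list_mult W xs \<in> carrier W"
  by (induction xs) (auto simp: list_mult_def)

lemma coord_list_mult:
  "set xs \<subseteq> carrier W \<Longrightarrow> coord (list_mult W xs) = product (map coord xs)"
proof (induction xs)
  case (Cons x xs)
  then show ?case
    using coord_mult[of x "list_mult W xs"] list_mult_closed[of xs] by (simp add: list_mult_def)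
qed (simp add: list_mult_def coord_one)

lemma coord_inverse:
  "X \<in> carrier W \<Longrightarrow> coord X \<odot> coord (inv\<^bsub>W\<^esub> X) = unit_elt"
  using coord_mult[of X "inv\<^bsub>W\<^esub> X"] by (simp add: coord_one)

lemma finite_carrier_W: "finite (carrier W)"
proof (rule finite_imageD)
  show "finite (coord ` carrier W)" by (simp add: coord_image)
  show "inj_on coord (carrier W)" using coord_inj by (blast intro: inj_onI)
qed


section \<open>The longest element and the center\<close>

lemma set_simple_reflections: "{s\<^sub>1, s\<^sub>2, s\<^sub>3} = range (generator coxeter_rels)"
  using set_indices by (metis image_insert image_empty list.simps(15) list.set(1))

lemma word_length_eq:
  "word_length X = (LEAST n. \<exists>u. length u = n \<and> word_class coxeter_rels (pos u) = X)"
proof -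
  have "list_mult W (map (generator coxeter_rels) u) = word_class coxeter_rels (pos u)" for u
  proof (induction u)
    case Nil
    then show ?case by (simp add: list_mult_def pos_def one_presented_group)
  next
    case (Cons i u)
    then show ?case
      by (simp add: list_mult_def generator_def presented_group_mult flip: pos_append)
  qed
  moreover have "set xs \<subseteq> {s\<^sub>1, s\<^sub>2, s\<^sub>3} \<longleftrightarrow> (\<exists>u. xs = map (generator coxeter_rels) u)" for xs
    unfolding set_simple_reflections ex_map_conv by blast
  ultimately have "(\<exists>xs. set xs \<subseteq> {s\<^sub>1, s\<^sub>2, s\<^sub>3} \<and> length xs = n \<and> list_mult W xs = X) \<longleftrightarrow>
      (\<exists>u. length u = n \<and> word_class coxeter_rels (pos u) = X)" for n
    by (metis length_map)
  then show ?thesis by (simp add: word_length_def)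
qed

text \<open>Any word for the same element reduces to a normal word that is no longer and has the
  same evaluation; by injectivity that normal word is \<open>w\<close>.\<close>

lemma word_length_normal:
  assumes "w \<in> set normal_words"
  shows "word_length (word_class coxeter_rels (pos w)) = length w"
  unfolding word_length_eq
proof (rule Least_equality)
  fix n assume "\<exists>u. length u = n \<and> word_class coxeter_rels (pos u) = word_class coxeter_rels (pos w)"
  then obtain u where u: "length u = n" "u \<doteq> w"
    by (auto simp: word_class_eq_iff word_equal_def)
  obtain v where v: "v \<in> set normal_words" "u \<doteq> v" "length v \<le> length u"
    using normal_form by blast
  have "w \<doteq> v"
    using u(2) v(2) word_equal_sym word_equal_trans by blast
  then have "eval_word w = eval_word v"
    using eval_word_same_element by (fastforce simp: word_equal_def)
  then have "w = v"
    using assms v(1) by (rule inj_onD[OF eval_word_inj])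
  then show "length w \<le> n" using u(1) v(3) by simp
qed blast

lemma longest_normal_word:
  "\<exists>w\<in>set normal_words. length w = 15 \<and> eval_word w = (ide, True) \<and>
    (\<forall>v\<in>set normal_words. v = w \<or> length v < 15)"
proof -
  \<comment> \<open>The longest dihedral word, of length 5, followed by the longest coset word, of
    length 10.\<close>
  let ?w = "[I1, I2, I1, I2, I1, I3, I2, I1, I2, I1, I3, I2, I1, I2, I3]"
  have "?w \<in> set normal_words \<and> length ?w = 15 \<and> eval_word ?w = (ide, True)"
    by code_simp
  moreover have "\<forall>v\<in>set normal_words. v = ?w \<or> length v < 15"
    by code_simp
  ultimately show ?thesis by blast
qed

lemma longest_element: "w\<^sub>0 \<in> carrier W" "coord w\<^sub>0 = (ide, True)"
proof -
  obtain w where w: "w \<in> set normal_words" "length w = 15" "eval_word w = (ide, True)"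
    "\<And>v. v \<in> set normal_words \<Longrightarrow> v = w \<or> length v < 15"
    using longest_normal_word by blast
  have "w\<^sub>0 = word_class coxeter_rels (pos w)"
    unfolding longest_element_def
  proof (rule the_equality)
    have "word_length X \<le> 15" if "X \<in> carrier W" for X
      using that w(2,4) by (metis carrier_W_normal word_length_normal less_imp_le order_refl)
    then show "word_class coxeter_rels (pos w) \<in> carrier W \<and>
        (\<forall>v\<in>carrier W. word_length v \<le> word_length (word_class coxeter_rels (pos w)))"
      by (simp add: word_length_normal w)
  next
    fix X assume X: "X \<in> carrier W \<and> (\<forall>v\<in>carrier W. word_length v \<le> word_length X)"
    then obtain v where v: "v \<in> set normal_words" "X = word_class coxeter_rels (pos v)"
      by (auto elim: carrier_W_normal)
    have "15 \<le> word_length X"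
      using X word_length_normal[OF w(1)] w(2) by (metis word_class_carrier)
    then show "X = word_class coxeter_rels (pos w)"
      using w(4)[OF v(1)] by (auto simp: v word_length_normal[OF v(1)])
  qed
  then show "w\<^sub>0 \<in> carrier W" "coord w\<^sub>0 = (ide, True)"
    using w(3) by (metis word_class_carrier, metis coord_word_class map_fst_pos)
qed

text \<open>The two permutations generate a dihedral group of order 10, whose centralizer in
  \<open>A_5\<close> is trivial.\<close>

lemma alternating_center:
  "\<forall>p\<in>set alternating. p \<cdot> gen_perm I1 = gen_perm I1 \<cdot> p \<and> p \<cdot> gen_perm I2 = gen_perm I2 \<cdot> p \<longrightarrow> p = ide"
  by code_simp

lemma center_W: "center W = {X \<in> carrier W. fst (coord X) = ide}"
proof (intro equalityI subsetI)
  fix X assume X: "X \<in> center W"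
  then have "X \<in> carrier W" by (simp add: center_def)
  have "fst (coord X) \<cdot> gen_perm i = gen_perm i \<cdot> fst (coord X)" for i
  proof -
    have "X \<otimes>\<^bsub>W\<^esub> generator coxeter_rels i = generator coxeter_rels i \<otimes>\<^bsub>W\<^esub> X"
      using X by (simp add: center_def)
    then have "coord X \<odot> (gen_perm i, True) = (gen_perm i, True) \<odot> coord X"
      using \<open>X \<in> carrier W\<close> by (metis coord_mult coord_generator generator_carrier)
    then show ?thesis by (metis fst_mul fst_conv)
  qed
  then show "X \<in> {X \<in> carrier W. fst (coord X) = ide}"
    using alternating_center coord_alternating \<open>X \<in> carrier W\<close> by blast
next
  fix X assume "X \<in> {X \<in> carrier W. fst (coord X) = ide}"
  then have X: "X \<in> carrier W" "fst (coord X) = ide" by auto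
  have "X \<otimes>\<^bsub>W\<^esub> Y = Y \<otimes>\<^bsub>W\<^esub> X" if "Y \<in> carrier W" for Y
    using X that by (intro coord_inj) (auto simp: coord_mult prod_eq_iff)
  then show "X \<in> center W" using X by (simp add: center_def)
qed

lemma subgroup_center_W: "subgroup (center W) W"
proof (rule W.subgroupI)
  show "center W \<subseteq> carrier W" by (auto simp: center_def)
  show "center W \<noteq> {}"
    using longest_element by (auto simp: center_W)
  show "inv\<^bsub>W\<^esub> X \<in> center W" if "X \<in> center W" for X
    using that arg_cong[OF coord_inverse[of X], of fst] by (simp add: center_W unit_elt_def)
  show "X \<otimes>\<^bsub>W\<^esub> Y \<in> center W" if "X \<in> center W" "Y \<in> center W" for X Y
    using that by (simp add: center_W coord_mult)
qed


section \<open>Automorphisms of \<open>W\<close>\<close>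

text \<open>The equations are imposed on all tables, so they can be used without membership side
  conditions. Conjugation by any permutation qualifies; an odd one induces an outer automorphism of
  \<open>A_5\<close>.\<close>

definition perm_auto :: "(perm \<Rightarrow> perm) \<Rightarrow> bool" where
  "perm_auto g \<longleftrightarrow> inj g \<and> g ide = ide \<and> (\<forall>p q. g (p \<cdot> q) = g p \<cdot> g q) \<and>
    (\<forall>p\<in>set alternating. g p \<in> set alternating)"

lemma perm_auto_comp: "perm_auto f \<Longrightarrow> perm_auto g \<Longrightarrow> perm_auto (g \<circ> f)"
  unfolding perm_auto_def by (auto intro: inj_compose)

lemma auto_of_perm_auto:
  assumes "perm_auto g"
  obtains \<alpha> where "\<alpha> \<in> auto W"
    "\<And>X. X \<in> carrier W \<Longrightarrow> coord (\<alpha> X) = map_prod g id (coord X)"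
proof
  \<comment> \<open>The map acts by \<open>g\<close> on the permutation and fixes the sign. It is
    restricted because members of \<open>auto W\<close> are extensional.\<close>
  define \<alpha> where
    "\<alpha> = restrict (\<lambda>X. SOME Y. Y \<in> carrier W \<and> coord Y = map_prod g id (coord X)) (carrier W)"
  have \<alpha>: "\<alpha> X \<in> carrier W \<and> coord (\<alpha> X) = map_prod g id (coord X)" if X: "X \<in> carrier W" for X
  proof -
    have "g (fst (coord X)) \<in> set alternating"
      using assms coord_alternating[OF X] by (auto simp: perm_auto_def)
    then obtain Y where "Y \<in> carrier W" "coord Y = (g (fst (coord X)), snd (coord X))"
      by (rule coord_surj)
    then have "\<exists>Y. Y \<in> carrier W \<and> coord Y = map_prod g id (coord X)"
      by (auto simp: prod_eq_iff)
    from someI_ex[OF this] show ?thesis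
      using X by (simp add: \<alpha>_def)
  qed
  then show "coord (\<alpha> X) = map_prod g id (coord X)" if "X \<in> carrier W" for X
    using that by simp
  have "inj_on \<alpha> (carrier W)"
  proof (rule inj_onI)
    fix X Y assume XY: "X \<in> carrier W" "Y \<in> carrier W" "\<alpha> X = \<alpha> Y"
    then have "map_prod g id (coord X) = map_prod g id (coord Y)" using \<alpha> by metis
    then have "coord X = coord Y"
      using assms by (auto simp: perm_auto_def prod_eq_iff dest: injD)
    then show "X = Y" using XY coord_inj by blast
  qed
  moreover have "\<alpha> ` carrier W \<subseteq> carrier W" using \<alpha> by blast
  \<comment> \<open>An injective self-map of the finite carrier is onto.\<close>
  ultimately have "bij_betw \<alpha> (carrier W) (carrier W)"
    using finite_carrier_W by (simp add: bij_betw_def endo_inj_surj)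
  moreover have "\<alpha> \<in> extensional (carrier W)" by (simp add: \<alpha>_def)
  moreover have "\<alpha> \<in> hom W W"
  proof (rule homI)
    show "\<alpha> X \<in> carrier W" if "X \<in> carrier W" for X using that \<alpha> by simp
    fix X Y assume XY: "X \<in> carrier W" "Y \<in> carrier W"
    then have "coord (\<alpha> (X \<otimes>\<^bsub>W\<^esub> Y)) = coord (\<alpha> X \<otimes>\<^bsub>W\<^esub> \<alpha> Y)"
      using \<alpha> assms by (simp add: coord_mult perm_auto_def prod_eq_iff)
    then show "\<alpha> (X \<otimes>\<^bsub>W\<^esub> Y) = \<alpha> X \<otimes>\<^bsub>W\<^esub> \<alpha> Y"
      using \<alpha> XY coord_inj by simp
  qed
  ultimately show "\<alpha> \<in> auto W" by (simp add: auto_def Bij_def)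
qed

definition conj_perm :: "perm \<Rightarrow> perm \<Rightarrow> perm" where
  "conj_perm p q = p \<cdot> q \<cdot> perm_inverse p"

text \<open>Testing the images of the three generators is cheap to evaluate, and it already forces
  all of \<open>alternating\<close> to be preserved because the generators produce it.\<close>

definition normalizing :: "perm \<Rightarrow> bool" where
  "normalizing p \<longleftrightarrow> perm_inverse p \<cdot> p = ide \<and> p \<cdot> perm_inverse p = ide \<and>
    (\<forall>i\<in>set [I1, I2, I3]. conj_perm p (gen_perm i) \<in> set alternating)"

text \<open>Transported from the multiplication of \<open>W\<close> along \<open>coord\<close>,
  which avoids checking 3600 products.\<close>

lemma alternating_comp: "p \<in> set alternating \<Longrightarrow> q \<in> set alternating \<Longrightarrow> p \<cdot> q \<in> set alternating"
  by (metis coord_surj coord_mult coord_alternating W.m_closed fst_mul fst_conv)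

lemma normalizing_inverse:
  assumes "normalizing p"
  shows "perm_inverse p \<cdot> (p \<cdot> r) = r" "p \<cdot> perm_inverse p = ide" "perm_inverse p \<cdot> p = ide"
  using assms unfolding normalizing_def by (metis comp_assoc ide_comp)+

lemma conj_perm_comp:
  "normalizing p \<Longrightarrow> conj_perm p (q \<cdot> r) = conj_perm p q \<cdot> conj_perm p r"
  by (simp add: conj_perm_def comp_assoc normalizing_inverse)

lemma conj_perm_ide: "normalizing p \<Longrightarrow> conj_perm p ide = ide"
  by (simp add: conj_perm_def normalizing_inverse)

lemma conj_perm_inj:
  assumes "normalizing p" "conj_perm p q = conj_perm p r"
  shows "q = r"
proof -
  have "perm_inverse p \<cdot> conj_perm p q \<cdot> p = perm_inverse p \<cdot> conj_perm p r \<cdot> p"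
    using assms(2) by simp
  then show ?thesis by (simp add: conj_perm_def comp_assoc normalizing_inverse assms(1))
qed

lemma conj_perm_alternating:
  assumes "normalizing p" "q \<in> set alternating"
  shows "conj_perm p q \<in> set alternating"
proof -
  have gen_perm: "conj_perm p (gen_perm i) \<in> set alternating" for i
    using assms(1) set_indices unfolding normalizing_def by blast
  have ide: "ide \<in> set alternating" by code_simp
  have word: "conj_perm p (fst (eval_word u)) \<in> set alternating" for u
  proof (induction u)
    case Nil
    then show ?case using ide assms(1) by (simp add: eval_word_def unit_elt_def conj_perm_ide)
  next
    case (Cons i u)
    then show ?case
      using alternating_comp gen_perm assms(1) by (simp add: eval_word_def conj_perm_comp)
  qed
  obtain X where "X \<in> carrier W" "coord X = (q, True)"
    using assms(2) by (rule coord_surj)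
  then obtain u where "fst (eval_word u) = q"
    by (metis carrier_presented_groupE coord_word_class fst_conv)
  then show ?thesis using word by blast
qed

lemma perm_auto_conj:
  assumes "normalizing p"
  shows "perm_auto (conj_perm p)"
  unfolding perm_auto_def
  using conj_perm_comp[OF assms] conj_perm_ide[OF assms] conj_perm_alternating[OF assms]
    injI[of "conj_perm p", OF conj_perm_inj[OF assms]] by blast


section \<open>Triples satisfying the Artin relations\<close>

definition artin_triple :: "perm \<Rightarrow> perm \<Rightarrow> perm \<Rightarrow> bool" where
  "artin_triple x y z \<longleftrightarrow> x \<cdot> y \<cdot> x \<cdot> y \<cdot> x = y \<cdot> x \<cdot> y \<cdot> x \<cdot> y \<and> x \<cdot> z = z \<cdot> x \<and> y \<cdot> z \<cdot> y = z \<cdot> y \<cdot> z"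

text \<open>The permutation parts of the values of \<open>nu_3^3\<close>: three 5-cycles, the first
  and third inverse to each other.\<close>

fun nu_perm :: "index \<Rightarrow> perm" where
  "nu_perm I1 = Perm P3 P4 P1 P2 P0"
| "nu_perm I2 = Perm P3 P0 P1 P4 P2"
| "nu_perm I3 = Perm P4 P2 P3 P0 P1"

definition symmetric_perms :: "perm list" where
  "symmetric_perms = alternating @ map (\<lambda>p. Perm P1 P0 P2 P3 P4 \<cdot> p) alternating"

text \<open>One permutation for each cycle type in \<open>A_5\<close>: identity, double
  transposition, 3-cycle, 5-cycle. The 5-cycles form two classes in \<open>A_5\<close>, which the
  odd members of \<open>symmetric_perms\<close> merge.\<close>

definition type_representatives :: "perm list" where
  "type_representatives = [ide, gen_perm I1, gen_perm I2 \<cdot> gen_perm I3, nu_perm I1]"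

text \<open>Phrased with \<open>find\<close> and \<open>if\<close> so that evaluation stops at the
  first conjugator and tests \<open>normalizing\<close> only after a match.\<close>

lemma cycle_types:
  "\<forall>x\<in>set alternating.
    find (\<lambda>p. if conj_perm p x \<in> set type_representatives then normalizing p else False)
      symmetric_perms \<noteq> None"
  by code_simp

text \<open>The search is kept small by fixing \<open>x\<close> up to conjugation and drawing
  \<open>z\<close> from its centralizer before filtering \<open>y\<close>. If \<open>x = y\<close>,
  then \<open>x\<close> and \<open>z\<close> commute and satisfy the braid relation, which forces
  \<open>x = z\<close>.\<close>

lemma triples_of_type:
  "\<forall>x\<in>set type_representatives. \<forall>z\<in>set (filter (\<lambda>z. x \<cdot> z = z \<cdot> x) alternating).
    \<forall>y\<in>set (filter (\<lambda>y. artin_triple x y z) alternating).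
      if x = y then y = z else
      find (\<lambda>p. if [conj_perm p x, conj_perm p y, conj_perm p z]
          \<in> set [map gen_perm [I1, I2, I3], map nu_perm [I1, I2, I3]] then normalizing p else False)
        symmetric_perms \<noteq> None"
  by code_simp

lemma artin_triple_conj:
  assumes "normalizing p" "artin_triple x y z"
  shows "artin_triple (conj_perm p x) (conj_perm p y) (conj_perm p z)"
  using assms(2) unfolding artin_triple_def by (metis conj_perm_comp[OF assms(1)])

definition standard_triple :: "(index \<Rightarrow> perm) \<Rightarrow> bool" where
  "standard_triple x \<longleftrightarrow> x = gen_perm \<or> x = nu_perm"

lemma standard_tripleI:
  assumes "[x I1, x I2, x I3] \<in> set [map gen_perm [I1, I2, I3], map nu_perm [I1, I2, I3]]"
  shows "standard_triple x"
proof -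
  have eqI: "x = y" if "x I1 = y I1" "x I2 = y I2" "x I3 = y I3" for y
  proof
    show "x i = y i" for i using that by (cases i) simp_all
  qed
  show ?thesis
    using assms eqI[of gen_perm] eqI[of nu_perm] unfolding standard_triple_def
    by (simp del: gen_perm.simps nu_perm.simps) blast
qed

text \<open>The first conjugation moves \<open>x I1\<close> to the representative of its cycle type.\<close>

lemma artin_triple_classification:
  assumes "\<And>i. x i \<in> set alternating" "artin_triple (x I1) (x I2) (x I3)"
    and "\<not> (x I1 = x I2 \<and> x I2 = x I3)"
  obtains g where "perm_auto g" "standard_triple (\<lambda>i. g (x i))"
proof -
  obtain p where p: "normalizing p" "conj_perm p (x I1) \<in> set type_representatives"
    using bspec[OF cycle_types assms(1)[of I1]] by (auto simp: find_None_iff split: if_splits)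
  define u where "u i = conj_perm p (x i)" for i
  have u: "u i \<in> set alternating" for i
    using conj_perm_alternating[OF p(1) assms(1)] by (simp add: u_def)
  have "artin_triple (u I1) (u I2) (u I3)"
    using artin_triple_conj[OF p(1) assms(2)] by (simp add: u_def)
  then have u3: "u I3 \<in> set (filter (\<lambda>z. u I1 \<cdot> z = z \<cdot> u I1) alternating)"
    and u2: "u I2 \<in> set (filter (\<lambda>y. artin_triple (u I1) y (u I3)) alternating)"
    using u by (simp_all add: artin_triple_def)
  have u1: "u I1 \<in> set type_representatives"
    using p(2) by (simp add: u_def)
  have *: "if u I1 = u I2 then u I2 = u I3 else
      find (\<lambda>p. if [conj_perm p (u I1), conj_perm p (u I2), conj_perm p (u I3)]
          \<in> set [map gen_perm [I1, I2, I3], map nu_perm [I1, I2, I3]] then normalizing p else False)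
        symmetric_perms \<noteq> None"
    using bspec[OF bspec[OF bspec[OF triples_of_type u1] u3] u2] .
  \<comment> \<open>A constant triple \<open>u\<close> would make \<open>x\<close> constant, since
    conjugation by \<open>p\<close> is injective.\<close>
  have "u I1 \<noteq> u I2"
  proof
    assume "u I1 = u I2"
    with * have "u I2 = u I3" by simp
    with \<open>u I1 = u I2\<close> show False
      using conj_perm_inj[OF p(1)] assms(3) unfolding u_def by blast
  qed
  with * obtain q where q: "normalizing q"
    "[conj_perm q (u I1), conj_perm q (u I2), conj_perm q (u I3)]
      \<in> set [map gen_perm [I1, I2, I3], map nu_perm [I1, I2, I3]]"
    unfolding if_not_P[OF \<open>u I1 \<noteq> u I2\<close>] find_None_iff by (metis (mono_tags, lifting))
  show ?thesis
  proof (rule that)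
    show "perm_auto (conj_perm q \<circ> conj_perm p)"
      using p(1) q(1) by (intro perm_auto_comp perm_auto_conj)
    show "standard_triple (\<lambda>i. (conj_perm q \<circ> conj_perm p) (x i))"
      using standard_tripleI[of "\<lambda>i. conj_perm q (u i)"] q(2) by (simp add: u_def)
  qed
qed


section \<open>Homomorphisms from \<open>A\<close> to \<open>W\<close>\<close>

definition hom_coord :: "(index gword set \<Rightarrow> index gword set) \<Rightarrow> index \<Rightarrow> elt" where
  "hom_coord \<phi> i = coord (\<phi> (generator artin_rels i))"

lemma hom_generator: "\<phi> \<in> hom A W \<Longrightarrow> \<phi> (generator artin_rels i) \<in> carrier W"
  by (simp add: hom_in_carrier)

lemma coord_artin_word:
  assumes "\<phi> \<in> hom A W"
  shows "coord (\<phi> (word_class artin_rels (pos u))) = product (map (hom_coord \<phi>) u)"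
proof -
  have "coord (\<phi> (word_class artin_rels (pos u)))
      = product (map coord (map (\<lambda>i. \<phi> (generator artin_rels i)) u))"
    unfolding W.hom_word_value[OF assms] W.word_value_pos
    using hom_generator[OF assms] by (intro coord_list_mult) auto
  then show ?thesis by (simp add: hom_coord_def[abs_def] comp_def)
qed

lemma product_artin_relation:
  assumes "\<phi> \<in> hom A W" "(pos u, pos v) \<in> artin_rels"
  shows "product (map (hom_coord \<phi>) u) = product (map (hom_coord \<phi>) v)"
proof -
  have "word_class artin_rels (pos u) = word_class artin_rels (pos v)"
    using same_element.rel[OF assms(2), of "[]" "[]"] by (simp add: word_class_eq_iff)
  then show ?thesis using coord_artin_word[OF assms(1)] by metis
qed

lemma fst_hom_coord: "\<phi> \<in> hom A W \<Longrightarrow> fst (hom_coord \<phi> i) \<in> set alternating"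
  unfolding hom_coord_def by (intro coord_alternating hom_generator)

lemma fst_product: "fst (product xs) = foldr (\<cdot>) (map fst xs) ide"
  by (induction xs) (simp_all add: unit_elt_def)

lemma hom_coord_artin_triple:
  assumes "\<phi> \<in> hom A W"
  shows "artin_triple (fst (hom_coord \<phi> I1)) (fst (hom_coord \<phi> I2)) (fst (hom_coord \<phi> I3))"
proof -
  note relation = product_artin_relation[OF assms, THEN arg_cong[of _ _ fst]]
  show ?thesis
    using relation[of "[I1, I2, I1, I2, I1]" "[I2, I1, I2, I1, I2]"]
      relation[of "[I1, I3]" "[I3, I1]"] relation[of "[I2, I3, I2]" "[I3, I2, I3]"]
    by (simp add: artin_triple_def artin_rels_def fst_product comp_assoc)
qed

text \<open>All three generators of \<open>A\<close> are conjugate, hence have the same sign.\<close>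

lemma snd_hom_coord:
  assumes "\<phi> \<in> hom A W"
  shows "snd (hom_coord \<phi> i) = snd (hom_coord \<phi> I1)"
proof -
  note relation = product_artin_relation[OF assms, THEN arg_cong[of _ _ snd]]
  have "snd (hom_coord \<phi> I2) = snd (hom_coord \<phi> I1)" "snd (hom_coord \<phi> I3) = snd (hom_coord \<phi> I2)"
    using relation[of "[I1, I2, I1, I2, I1]" "[I2, I1, I2, I1, I2]"]
      relation[of "[I2, I3, I2]" "[I3, I2, I3]"]
    by (auto simp: artin_rels_def)
  then show ?thesis by (cases i) simp_all
qed

text \<open>Constructs the two representatives later on. With all signs +1, the Artin relations hold
  in \<open>W\<close> as soon as they hold for the permutations.\<close>

lemma hom_with_coord:
  assumes "\<And>i. x i \<in> set alternating" "artin_triple (x I1) (x I2) (x I3)"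
  obtains \<phi> where "\<phi> \<in> hom A W" "\<And>i. hom_coord \<phi> i = (x i, False)"
proof -
  have "\<exists>X. X \<in> carrier W \<and> coord X = (x i, False)" for i
    using coord_surj[OF assms(1)] by metis
  then obtain f where f: "f i \<in> carrier W" "coord (f i) = (x i, False)" for i by metis
  have val: "word_value W f (pos u) \<in> carrier W"
    "coord (word_value W f (pos u)) = product (map (\<lambda>i. (x i, False)) u)" for u
  proof -
    show "word_value W f (pos u) \<in> carrier W"
      by (rule W.word_value_closed[of f, OF f(1)])
    show "coord (word_value W f (pos u)) = product (map (\<lambda>i. (x i, False)) u)"
      using f coord_list_mult[of "map f u"] by (simp add: W.word_value_pos comp_def image_subset_iff)
  qed
  have eq: "word_value W f (pos u) = word_value W f (pos v)"
    if "product (map (\<lambda>i. (x i, False)) u) = product (map (\<lambda>i. (x i, False)) v)" for u v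
    using val that by (intro coord_inj) simp_all
  have
    "word_value W f (pos [I1, I2, I1, I2, I1]) = word_value W f (pos [I2, I1, I2, I1, I2])"
    "word_value W f (pos [I1, I3]) = word_value W f (pos [I3, I1])"
    "word_value W f (pos [I2, I3, I2]) = word_value W f (pos [I3, I2, I3])"
    using assms(2) by (intro eq; simp add: artin_triple_def unit_elt_def comp_assoc)+
  then have "word_value W f u = word_value W f v" if "(u, v) \<in> artin_rels" for u v
    using that unfolding artin_rels_def by blast
  then obtain \<phi> where "\<phi> \<in> hom A W" "\<And>i. \<phi> (generator artin_rels i) = f i"
    using W.presented_group_lift[of f artin_rels, OF f(1)] by metis
  then show ?thesis using f(2) by (intro that) (auto simp: hom_coord_def)
qed

section \<open>Images of homomorphisms and the center\<close>

lemma image_subset_subgroup: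
  assumes "\<phi> \<in> hom A W" "subgroup K W" "\<And>i. \<phi> (generator artin_rels i) \<in> K"
  shows "\<phi> ` carrier A \<subseteq> K"
  using W.word_value_subgroup[OF assms(2), of "\<lambda>i. \<phi> (generator artin_rels i)", OF assms(3)]
  by (auto elim!: carrier_presented_groupE simp: W.hom_word_value[OF assms(1)])

text \<open>\<open>K\<close> contains all products of an image element and a central element. It is
  applied to a centralizer, to the center and to the image itself.\<close>

lemma up_to_center_epi_subgroup:
  assumes "\<phi> \<in> up_to_center_epi A W" "subgroup K W" "\<phi> ` carrier A \<subseteq> K" "center W \<subseteq> K"
  shows "K = carrier W"
proof
  show "K \<subseteq> carrier W" using assms(2) by (rule subgroup.subset)
  have "(\<phi> ` carrier A) <#>\<^bsub>W\<^esub> center W \<subseteq> K"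
    using assms(2-4) by (auto simp: set_mult_def subset_iff intro: subgroup.m_closed)
  then show "carrier W \<subseteq> K"
    using assms(1) by (simp add: up_to_center_epi_def)
qed

lemma subgroup_centralizer:
  assumes "X \<in> carrier W"
  shows "subgroup {Y \<in> carrier W. Y \<otimes>\<^bsub>W\<^esub> X = X \<otimes>\<^bsub>W\<^esub> Y} W" (is "subgroup ?C W")
proof (rule W.subgroupI)
  show "?C \<noteq> {}" using assms by blast
  show "inv\<^bsub>W\<^esub> Y \<in> ?C" if "Y \<in> ?C" for Y
  proof -
    have Y: "Y \<in> carrier W" "Y \<otimes>\<^bsub>W\<^esub> X = X \<otimes>\<^bsub>W\<^esub> Y" using that by auto
    have "inv\<^bsub>W\<^esub> Y \<otimes>\<^bsub>W\<^esub> X = inv\<^bsub>W\<^esub> Y \<otimes>\<^bsub>W\<^esub> (X \<otimes>\<^bsub>W\<^esub> Y) \<otimes>\<^bsub>W\<^esub> inv\<^bsub>W\<^esub> Y"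
      using Y(1) assms by (simp add: W.m_assoc)
    also have "\<dots> = X \<otimes>\<^bsub>W\<^esub> inv\<^bsub>W\<^esub> Y"
      unfolding Y(2)[symmetric] using Y(1) assms by (simp flip: W.m_assoc)
    finally show ?thesis using Y(1) by simp
  qed
  show "Y \<otimes>\<^bsub>W\<^esub> Z \<in> ?C" if "Y \<in> ?C" "Z \<in> ?C" for Y Z
  proof -
    have YZ: "Y \<in> carrier W" "Y \<otimes>\<^bsub>W\<^esub> X = X \<otimes>\<^bsub>W\<^esub> Y"
      "Z \<in> carrier W" "Z \<otimes>\<^bsub>W\<^esub> X = X \<otimes>\<^bsub>W\<^esub> Z" using that by auto
    have "Y \<otimes>\<^bsub>W\<^esub> Z \<otimes>\<^bsub>W\<^esub> X = Y \<otimes>\<^bsub>W\<^esub> X \<otimes>\<^bsub>W\<^esub> Z"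
      using YZ(1,3,4) assms by (simp add: W.m_assoc)
    also have "\<dots> = X \<otimes>\<^bsub>W\<^esub> (Y \<otimes>\<^bsub>W\<^esub> Z)"
      unfolding YZ(2) using YZ(1,3) assms by (simp add: W.m_assoc)
    finally show ?thesis using YZ(1,3) by simp
  qed
qed auto

text \<open>As the signs agree, all generators would have one common value \<open>X\<close>. The
  centralizer of \<open>X\<close> contains the image and the center, so \<open>X\<close> is central;
  then the image is central and \<open>W\<close> equals its center, contradicting that
  \<open>s\<^sub>1\<close> is not central.\<close>

lemma up_to_center_epi_not_constant:
  assumes "\<phi> \<in> up_to_center_epi A W"
  shows "\<not> (fst (hom_coord \<phi> I1) = fst (hom_coord \<phi> I2) \<and> fst (hom_coord \<phi> I2) = fst (hom_coord \<phi> I3))"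
proof
  assume *: "fst (hom_coord \<phi> I1) = fst (hom_coord \<phi> I2) \<and> fst (hom_coord \<phi> I2) = fst (hom_coord \<phi> I3)"
  have \<phi>: "\<phi> \<in> hom A W" using assms by (simp add: up_to_center_epi_def)
  define X where "X = \<phi> \<sigma>\<^sub>1"
  have X: "X \<in> carrier W" unfolding X_def using \<phi> by (rule hom_generator)
  have "hom_coord \<phi> i = hom_coord \<phi> I1" for i
    using * snd_hom_coord[OF \<phi>, of i] by (cases i) (auto simp: prod_eq_iff)
  then have const: "\<phi> (generator artin_rels i) = X" for i
    unfolding X_def hom_coord_def using hom_generator[OF \<phi>] coord_inj by blast
  let ?C = "{Y \<in> carrier W. Y \<otimes>\<^bsub>W\<^esub> X = X \<otimes>\<^bsub>W\<^esub> Y}"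
  have "\<phi> ` carrier A \<subseteq> ?C"
    using subgroup_centralizer[OF X] X by (intro image_subset_subgroup[OF \<phi>]) (auto simp: const)
  moreover have "center W \<subseteq> ?C" using X by (auto simp: center_def)
  ultimately have "?C = carrier W"
    using subgroup_centralizer[OF X] by (intro up_to_center_epi_subgroup[OF assms])
  then have "X \<in> center W" using X by (auto simp: center_def)
  then have "\<phi> ` carrier A \<subseteq> center W"
    by (intro image_subset_subgroup[OF \<phi> subgroup_center_W]) (simp add: const)
  then have "center W = carrier W"
    by (intro up_to_center_epi_subgroup[OF assms subgroup_center_W]) simp_all
  then have "s\<^sub>1 \<in> center W" by simp
  then show False
    by (simp add: center_W coord_generator ide_def)
qed

text \<open>The center consists of the elements with trivial permutation part, so the image only has
  to reach every permutation; the remaining factor \<open>inv \<phi> Y\<close> times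
  \<open>X\<close> is central.\<close>

lemma up_to_center_epiI:
  assumes "\<phi> \<in> hom A W"
    and "\<And>i. \<exists>Y\<in>carrier A. fst (coord (\<phi> Y)) = gen_perm i"
  shows "\<phi> \<in> up_to_center_epi A W"
proof -
  interpret \<phi>: group_hom A W \<phi>
    using assms(1)
    by (simp add: group_hom_def group_hom_axioms_def group_presented_group)
  have word: "\<exists>Y\<in>carrier A. fst (coord (\<phi> Y)) = fst (eval_word w)" for w
  proof (induction w)
    case Nil
    have "fst (coord (\<phi> \<one>\<^bsub>A\<^esub>)) = fst (eval_word [])"
      using coord_one by (simp add: eval_word_def)
    then show ?case by blast
  next
    case (Cons i w)
    then obtain Y where Y: "Y \<in> carrier A" "fst (coord (\<phi> Y)) = fst (eval_word w)" by blast
    obtain Z where Z: "Z \<in> carrier A" "fst (coord (\<phi> Z)) = gen_perm i" using assms(2) by blast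
    have "fst (coord (\<phi> (Z \<otimes>\<^bsub>A\<^esub> Y))) = fst (eval_word (i # w))"
      using Y Z by (simp add: coord_mult eval_word_def)
    then show ?case using Y(1) Z(1) by blast
  qed
  have "X \<in> (\<phi> ` carrier A) <#>\<^bsub>W\<^esub> center W" if X: "X \<in> carrier W" for X
  proof -
    obtain u where "X = word_class coxeter_rels u"
      using X by (rule carrier_presented_groupE)
    then obtain Y where Y: "Y \<in> carrier A" "fst (coord (\<phi> Y)) = fst (coord X)"
      using word[of "map fst u"] by (auto simp: coord_word_class)
    have "inv\<^bsub>W\<^esub> \<phi> Y \<otimes>\<^bsub>W\<^esub> X \<in> center W"
    proof -
      have "coord (inv\<^bsub>W\<^esub> \<phi> Y) \<odot> coord (\<phi> Y) = unit_elt"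
        using Y(1) coord_mult[of "inv\<^bsub>W\<^esub> \<phi> Y" "\<phi> Y"] by (simp add: coord_one)
      then have "fst (coord (inv\<^bsub>W\<^esub> \<phi> Y)) \<cdot> fst (coord (\<phi> Y)) = ide"
        by (metis fst_mul unit_elt_def fst_conv)
      then show ?thesis using X Y by (simp add: center_W coord_mult)
    qed
    moreover have "X = \<phi> Y \<otimes>\<^bsub>W\<^esub> (inv\<^bsub>W\<^esub> \<phi> Y \<otimes>\<^bsub>W\<^esub> X)"
      using X Y(1) by (simp flip: W.m_assoc)
    ultimately show ?thesis using Y(1) unfolding set_mult_def by blast
  qed
  moreover have "(\<phi> ` carrier A) <#>\<^bsub>W\<^esub> center W \<subseteq> carrier W"
    by (auto simp: set_mult_def center_def)
  ultimately show ?thesis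
    using assms(1) by (auto simp: up_to_center_epi_def)
qed

lemma snd_coord_inverse: "X \<in> carrier W \<Longrightarrow> snd (coord (inv\<^bsub>W\<^esub> X)) = snd (coord X)"
  using arg_cong[OF coord_inverse, of X snd] by (simp add: unit_elt_def)

text \<open>The image lies in the kernel of the sign, which does not contain
  \<open>s\<^sub>1\<close>.\<close>

lemma not_epi:
  assumes "\<phi> \<in> hom A W" "\<And>i. \<not> snd (hom_coord \<phi> i)"
  shows "\<phi> \<notin> epi A W"
proof
  let ?K = "{X \<in> carrier W. \<not> snd (coord X)}"
  have "subgroup ?K W"
  proof (rule W.subgroupI)
    show "?K \<noteq> {}" using coord_one by (auto simp: unit_elt_def intro!: exI[of _ "\<one>\<^bsub>W\<^esub>"])
  qed (auto simp: snd_coord_inverse coord_mult)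
  then have "\<phi> ` carrier A \<subseteq> ?K"
    using assms hom_generator[OF assms(1)]
    by (intro image_subset_subgroup) (auto simp: hom_coord_def)
  moreover assume "\<phi> \<in> epi A W"
  ultimately have "carrier W \<subseteq> ?K"
    by (simp add: epi_def)
  then have "s\<^sub>1 \<in> ?K" using generator_carrier by (rule subsetD)
  then show False by (simp add: coord_generator)
qed

text \<open>If the generators have sign \<open>-1\<close>, then \<open>w\<^sub>0\<close> is the image of \<open>(\<sigma>\<^sub>1 \<sigma>\<^sub>2 \<sigma>\<^sub>3)\<^sup>5\<close>.\<close>

lemma epi_of_sign:
  assumes "\<phi> \<in> up_to_center_epi A W" "snd (hom_coord \<phi> I1)"
  shows "\<phi> \<in> epi A W"
proof -
  have \<phi>: "\<phi> \<in> hom A W" using assms(1) by (simp add: up_to_center_epi_def)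
  interpret \<phi>: group_hom A W \<phi>
    using \<phi> by (simp add: group_hom_def group_hom_axioms_def group_presented_group)
  define p where "p i = fst (hom_coord \<phi> i)" for i
  obtain g where g: "perm_auto g" "standard_triple (\<lambda>i. g (p i))"
    using artin_triple_classification[of p] fst_hom_coord[OF \<phi>] hom_coord_artin_triple[OF \<phi>]
      up_to_center_epi_not_constant[OF assms(1)] unfolding p_def by metis
  let ?u = "concat (replicate 5 [I1, I2, I3])"
  let ?X = "word_class artin_rels (pos ?u)"
  have hom_coord: "hom_coord \<phi> i = (p i, True)" for i
    using snd_hom_coord[OF \<phi>, of i] assms(2) by (simp add: prod_eq_iff p_def)
  have "g (foldr (\<cdot>) (map p us) ide) = foldr (\<cdot>) (map (\<lambda>i. g (p i)) us) ide" for us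
    using g(1) by (induction us) (simp_all add: perm_auto_def)
  moreover have "foldr (\<cdot>) (map y ?u) ide = ide" if "standard_triple y" for y
  proof -
    have "foldr (\<cdot>) (map gen_perm ?u) ide = ide" "foldr (\<cdot>) (map nu_perm ?u) ide = ide"
      by code_simp+
    with that show ?thesis by (auto simp: standard_triple_def)
  qed
  \<comment> \<open>The fifth power of the product is trivial for both standard triples; injectivity
    of \<open>g\<close> carries this back to \<open>p\<close>.\<close>
  ultimately have "g (foldr (\<cdot>) (map p ?u) ide) = g ide"
    using g by (metis perm_auto_def)
  then have "foldr (\<cdot>) (map p ?u) ide = ide"
    using g(1) unfolding perm_auto_def by (blast dest: injD)
  \<comment> \<open>The word has fifteen letters of sign -1, an odd number.\<close>
  then have "coord (\<phi> ?X) = (ide, True)"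
    unfolding coord_artin_word[OF \<phi>]
    by (simp add: prod_eq_iff hom_coord numeral_eq_Suc unit_elt_def)
  have "center W \<subseteq> \<phi> ` carrier A"
  proof
    fix Z assume Z: "Z \<in> center W"
    then have "coord Z = coord (\<phi> ?X) \<or> coord Z = coord (\<phi> \<one>\<^bsub>A\<^esub>)"
      using \<open>coord (\<phi> ?X) = (ide, True)\<close> coord_one
      by (auto simp: center_W prod_eq_iff unit_elt_def)
    then show "Z \<in> \<phi> ` carrier A"
      using Z coord_inj by (metis (no_types, lifting) center_W mem_Collect_eq \<phi>.hom_closed
          \<phi>.G.one_closed imageI word_class_carrier)
  qed
  then have "\<phi> ` carrier A = carrier W"
    using \<phi>.img_is_subgroup by (intro up_to_center_epi_subgroup[OF assms(1)]) simp_all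
  then show ?thesis using \<phi> by (simp add: epi_def)
qed

lemma proper_sign:
  assumes "\<phi> \<in> proper_up_to_center_epi A W"
  shows "\<not> snd (hom_coord \<phi> i)"
  using assms epi_of_sign snd_hom_coord[of \<phi> i]
  by (auto simp: proper_up_to_center_epi_def up_to_center_epi_def)

lemma proper_hom: "\<phi> \<in> proper_up_to_center_epi A W \<Longrightarrow> \<phi> \<in> hom A W"
  by (simp add: proper_up_to_center_epi_def up_to_center_epi_def)

text \<open>The last assumption says that the permutations \<open>x i\<close> generate
  \<open>A_5\<close>; the sign +1 prevents surjectivity.\<close>

lemma properI:
  assumes "\<phi> \<in> hom A W" "\<And>i. hom_coord \<phi> i = (x i, False)"
    and "\<And>i. \<exists>u. foldr (\<cdot>) (map x u) ide = gen_perm i"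
  shows "\<phi> \<in> proper_up_to_center_epi A W"
proof -
  have "\<exists>Y\<in>carrier A. fst (coord (\<phi> Y)) = gen_perm i" for i
  proof -
    obtain u where "foldr (\<cdot>) (map x u) ide = gen_perm i" using assms(3) by blast
    then have "fst (coord (\<phi> (word_class artin_rels (pos u)))) = gen_perm i"
      by (simp add: coord_artin_word[OF assms(1)] fst_product assms(2) comp_def)
    then show ?thesis using word_class_carrier by blast
  qed
  then show ?thesis
    using up_to_center_epiI[OF assms(1)] not_epi[OF assms(1)] assms(2)
    by (simp add: proper_up_to_center_epi_def)
qed

section \<open>Equivalence of homomorphisms\<close>

lemma hom_equiv_W: "equiv (hom A W) (hom_equiv A W)"
proof (rule equivI)
  show "hom_equiv A W \<subseteq> hom A W \<times> hom A W"
    by (auto simp: hom_equiv_def)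
  show "refl_on (hom A W) (hom_equiv A W)"
    using W.id_in_auto
    by (auto simp: refl_on_def hom_equiv_def hom_in_carrier
        intro!: bexI[of _ "\<lambda>x\<in>carrier W. x"])
  show "sym (hom_equiv A W)"
  proof (rule symI)
    fix \<phi> \<psi> assume "(\<phi>, \<psi>) \<in> hom_equiv A W"
    then obtain \<alpha> where \<alpha>: "\<phi> \<in> hom A W" "\<psi> \<in> hom A W" "\<alpha> \<in> auto W"
      "\<And>X. X \<in> carrier A \<Longrightarrow> \<psi> X = \<alpha> (\<phi> X)"
      by (auto simp: hom_equiv_def)
    let ?\<beta> = "restrict (inv_into (carrier W) \<alpha>) (carrier W)"
    have Bij: "\<alpha> \<in> hom W W" "\<alpha> \<in> Bij (carrier W)" using \<alpha>(3) by (simp_all add: auto_def)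
    have "?\<beta> \<in> auto W"
      using W.restrict_inv_into_hom[OF Bij] restrict_inv_into_Bij[OF Bij(2)]
      by (simp add: auto_def)
    moreover have "\<phi> X = ?\<beta> (\<psi> X)" if X: "X \<in> carrier A" for X
      using \<alpha>(4)[OF X] hom_in_carrier[OF \<alpha>(1) X] hom_in_carrier[OF \<alpha>(2) X] Bij(2)
      by (simp add: Bij_def bij_betw_def)
    ultimately show "(\<psi>, \<phi>) \<in> hom_equiv A W"
      using \<alpha>(1,2) unfolding hom_equiv_def by blast
  qed
  show "trans (hom_equiv A W)"
  proof (rule transI)
    fix \<phi> \<psi> \<chi> assume "(\<phi>, \<psi>) \<in> hom_equiv A W" "(\<psi>, \<chi>) \<in> hom_equiv A W"
    then obtain \<alpha> \<beta> where *: "\<phi> \<in> hom A W" "\<chi> \<in> hom A W" "\<alpha> \<in> auto W" "\<beta> \<in> auto W"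
      "\<And>X. X \<in> carrier A \<Longrightarrow> \<psi> X = \<alpha> (\<phi> X)" "\<And>X. X \<in> carrier A \<Longrightarrow> \<chi> X = \<beta> (\<psi> X)"
      by (auto simp: hom_equiv_def)
    have "compose (carrier W) \<beta> \<alpha> \<in> auto W"
      using *(3,4) W.hom_compose by (auto simp: auto_def compose_Bij W.group_axioms
          dest: group.hom_compose)
    moreover have "\<chi> X = compose (carrier W) \<beta> \<alpha> (\<phi> X)" if X: "X \<in> carrier A" for X
      using *(5,6)[OF X] hom_in_carrier[OF *(1) X] by (simp add: compose_def)
    ultimately show "(\<phi>, \<chi>) \<in> hom_equiv A W"
      using *(1,2) unfolding hom_equiv_def by blast
  qed
qed

lemma hom_equivI:
  assumes "\<phi> \<in> hom A W" "\<psi> \<in> hom A W" "perm_auto g"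
    and "\<And>i. hom_coord \<psi> i = map_prod g id (hom_coord \<phi> i)"
  shows "(\<phi>, \<psi>) \<in> hom_equiv A W"
proof -
  obtain \<alpha> where \<alpha>: "\<alpha> \<in> auto W" "\<And>X. X \<in> carrier W \<Longrightarrow> coord (\<alpha> X) = map_prod g id (coord X)"
    using auto_of_perm_auto[OF assms(3)] by metis
  have \<alpha>_hom: "\<alpha> \<in> hom W W" using \<alpha>(1) by (simp add: auto_def)
  have "\<psi> (generator artin_rels i) = (\<alpha> \<circ> \<phi>) (generator artin_rels i)" for i
    using assms(4)[of i] \<alpha>(2) hom_generator[OF assms(1)] hom_generator[OF assms(2)]
      hom_in_carrier[OF \<alpha>_hom] by (intro coord_inj) (simp_all add: hom_coord_def)
  then have "\<psi> X = (\<alpha> \<circ> \<phi>) X" if "X \<in> carrier A" for X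
    using W.hom_presented_group_eqI[OF assms(2) hom_compose[OF assms(1) \<alpha>_hom]] that by blast
  then show ?thesis using assms(1,2) \<alpha>(1) by (auto simp: hom_equiv_def)
qed

lemma alternating_standard: "gen_perm i \<in> set alternating" "nu_perm i \<in> set alternating"
proof -
  have "\<forall>i\<in>set [I1, I2, I3]. gen_perm i \<in> set alternating \<and> nu_perm i \<in> set alternating"
    by code_simp
  then show "gen_perm i \<in> set alternating" "nu_perm i \<in> set alternating"
    using set_indices by blast+
qed

text \<open>Automorphisms preserve orders: \<open>\<mu> \<sigma>\<^sub>1\<close> squares to the
  identity, whereas \<open>\<nu> \<sigma>\<^sub>1\<close> is a 5-cycle.\<close>

lemma not_hom_equiv:
  assumes "\<mu> \<in> hom A W" "\<nu> \<in> hom A W"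
    and "hom_coord \<mu> I1 = (gen_perm I1, False)" "hom_coord \<nu> I1 = (nu_perm I1, False)"
  shows "(\<mu>, \<nu>) \<notin> hom_equiv A W"
proof
  assume "(\<mu>, \<nu>) \<in> hom_equiv A W"
  then obtain \<alpha> where \<alpha>: "\<alpha> \<in> hom W W" "\<nu> \<sigma>\<^sub>1 = \<alpha> (\<mu> \<sigma>\<^sub>1)"
    by (auto simp: hom_equiv_def auto_def)
  note carrier = hom_generator[OF assms(1), of I1] hom_generator[OF assms(2), of I1]
  have "coord (\<mu> \<sigma>\<^sub>1 \<otimes>\<^bsub>W\<^esub> \<mu> \<sigma>\<^sub>1) = coord \<one>\<^bsub>W\<^esub>"
    using assms(3) carrier
    by (simp add: coord_mult coord_one hom_coord_def unit_elt_def ide_def)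
  then have "\<mu> \<sigma>\<^sub>1 \<otimes>\<^bsub>W\<^esub> \<mu> \<sigma>\<^sub>1 = \<one>\<^bsub>W\<^esub>"
    using carrier by (intro coord_inj) simp_all
  then have "\<nu> \<sigma>\<^sub>1 \<otimes>\<^bsub>W\<^esub> \<nu> \<sigma>\<^sub>1 = \<one>\<^bsub>W\<^esub>"
    using \<alpha> carrier(1) by (metis W.one_closed hom_mult hom_one W.group_axioms)
  then have "coord (\<nu> \<sigma>\<^sub>1) \<odot> coord (\<nu> \<sigma>\<^sub>1) = unit_elt"
    using carrier(2) by (metis coord_mult coord_one)
  then show False
    using assms(4) by (simp add: hom_coord_def unit_elt_def ide_def)
qed

theorem proposition2p6:
  shows "card (proper_up_to_center_epi A W // hom_equiv A W) = 2 \<and>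
    (\<exists>\<mu>'\<in>proper_up_to_center_epi A W. \<exists>\<nu>\<in>proper_up_to_center_epi A W.
      \<mu>' \<sigma>\<^sub>1 = s\<^sub>1 \<otimes>\<^bsub>W\<^esub> w\<^sub>0 \<and>
      \<mu>' \<sigma>\<^sub>2 = s\<^sub>2 \<otimes>\<^bsub>W\<^esub> w\<^sub>0 \<and>
      \<mu>' \<sigma>\<^sub>3 = s\<^sub>3 \<otimes>\<^bsub>W\<^esub> w\<^sub>0 \<and>
      \<nu> \<sigma>\<^sub>1 = list_mult W [s\<^sub>2, s\<^sub>1, s\<^sub>2, s\<^sub>1] \<and>
      \<nu> \<sigma>\<^sub>2 = list_mult W [s\<^sub>2, s\<^sub>1, s\<^sub>2, s\<^sub>1, s\<^sub>3, s\<^sub>2, s\<^sub>1, s\<^sub>2, s\<^sub>1, s\<^sub>3, s\<^sub>2, s\<^sub>1] \<and>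
      \<nu> \<sigma>\<^sub>3 = list_mult W [s\<^sub>1, s\<^sub>2, s\<^sub>1, s\<^sub>2] \<and>
      proper_up_to_center_epi A W // hom_equiv A W =
        {hom_equiv A W `` {\<mu>'}, hom_equiv A W `` {\<nu>}})"
proof -
  have triples: "artin_triple (gen_perm I1) (gen_perm I2) (gen_perm I3)"
    "artin_triple (nu_perm I1) (nu_perm I2) (nu_perm I3)"
    by code_simp+
  obtain \<mu> where \<mu>: "\<mu> \<in> hom A W" "\<And>i. hom_coord \<mu> i = (gen_perm i, False)"
    using hom_with_coord[OF alternating_standard(1) triples(1)] by metis
  obtain \<nu> where \<nu>: "\<nu> \<in> hom A W" "\<And>i. hom_coord \<nu> i = (nu_perm i, False)"
    using hom_with_coord[OF alternating_standard(2) triples(2)] by metis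
  have "foldr (\<cdot>) (map gen_perm [i]) ide = gen_perm i" for i by simp
  then have \<mu>_proper: "\<mu> \<in> proper_up_to_center_epi A W"
    using properI[OF \<mu>] by blast
  \<comment> \<open>Explicit words showing that the three 5-cycles generate
    \<open>A_5\<close>.\<close>
  have "foldr (\<cdot>) (map nu_perm [I2, I2, I1, I2]) ide = gen_perm I1"
    "foldr (\<cdot>) (map nu_perm [I2, I2, I1, I2, I1, I1]) ide = gen_perm I2"
    "foldr (\<cdot>) (map nu_perm [I2, I3, I3]) ide = gen_perm I3"
    by code_simp+
  then have "\<exists>u. foldr (\<cdot>) (map nu_perm u) ide = gen_perm i" for i
    by (cases i) blast+
  then have \<nu>_proper: "\<nu> \<in> proper_up_to_center_epi A W"
    using properI[OF \<nu>] by blast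
  \<comment> \<open>Multiplication by \<open>w\<^sub>0\<close> only flips the sign, so
    \<open>s\<^sub>i w\<^sub>0\<close> has permutation \<open>gen_perm i\<close> and sign
    +1.\<close>
  have \<mu>_value: "\<mu> (generator artin_rels i) = generator coxeter_rels i \<otimes>\<^bsub>W\<^esub> w\<^sub>0" for i
    using \<mu>(2)[of i] hom_generator[OF \<mu>(1)] longest_element
    by (intro coord_inj) (simp_all add: hom_coord_def coord_mult coord_generator)
  have \<nu>_value: "\<nu> (generator artin_rels i) = list_mult W (map (generator coxeter_rels) u)"
    if "eval_word u = (nu_perm i, False)" for i u
  proof -
    have "set (map (generator coxeter_rels) u) \<subseteq> carrier W" by auto
    then show ?thesis
      using that \<nu>(2)[of i] hom_generator[OF \<nu>(1)] list_mult_closed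
      by (intro coord_inj)
        (auto simp: hom_coord_def coord_list_mult coord_generator eval_word_def comp_def)
  qed
  have nu_words: "eval_word [I2, I1, I2, I1] = (nu_perm I1, False)"
    "eval_word [I2, I1, I2, I1, I3, I2, I1, I2, I1, I3, I2, I1] = (nu_perm I2, False)"
    "eval_word [I1, I2, I1, I2] = (nu_perm I3, False)"
    by code_simp+
  let ?E = "hom_equiv A W"
  have "(\<phi>, \<mu>) \<in> ?E \<or> (\<phi>, \<nu>) \<in> ?E" if \<phi>: "\<phi> \<in> proper_up_to_center_epi A W" for \<phi>
  proof -
    have hom: "\<phi> \<in> hom A W" and epi: "\<phi> \<in> up_to_center_epi A W"
      using \<phi> proper_hom by (auto simp: proper_up_to_center_epi_def)
    obtain g where g: "perm_auto g" "standard_triple (\<lambda>i. g (fst (hom_coord \<phi> i)))"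
      using artin_triple_classification[of "\<lambda>i. fst (hom_coord \<phi> i)"] fst_hom_coord[OF hom]
        hom_coord_artin_triple[OF hom] up_to_center_epi_not_constant[OF epi] by metis
    \<comment> \<open>Properness fixes the sign +1, which both representatives share, so only the
      permutation parts have to be matched.\<close>
    have "map_prod g id (hom_coord \<phi> i) = (g (fst (hom_coord \<phi> i)), False)" for i
      using proper_sign[OF \<phi>, of i] by (simp add: prod_eq_iff)
    then show ?thesis
      using g hom_equivI[OF hom \<mu>(1) g(1)] hom_equivI[OF hom \<nu>(1) g(1)] \<mu>(2) \<nu>(2)
      unfolding standard_triple_def by (metis (no_types))
  qed
  then have "?E `` {\<phi>} = ?E `` {\<mu>} \<or> ?E `` {\<phi>} = ?E `` {\<nu>}"
    if "\<phi> \<in> proper_up_to_center_epi A W" for \<phi>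
    using that equiv_class_eq[OF hom_equiv_W] by blast
  then have classes: "proper_up_to_center_epi A W // ?E = {?E `` {\<mu>}, ?E `` {\<nu>}}"
    using \<mu>_proper \<nu>_proper unfolding quotient_def by blast
  moreover have "?E `` {\<mu>} \<noteq> ?E `` {\<nu>}"
    using not_hom_equiv[OF \<mu>(1) \<nu>(1) \<mu>(2) \<nu>(2)] eq_equiv_class[OF _ hom_equiv_W \<nu>(1)] by blast
  ultimately have "card (proper_up_to_center_epi A W // ?E) = 2" by simp
  then show ?thesis
    using \<mu>_proper \<nu>_proper \<mu>_value \<nu>_value[OF nu_words(1)] \<nu>_value[OF nu_words(2)]
      \<nu>_value[OF nu_words(3)] classes
    by (intro conjI bexI[of _ \<mu>] bexI[of _ \<nu>]) simp_all
qed

end
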